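(* Let $(\phi_n)_{n\ge1}$ be an approximating sequence for $\phi$, let $d\in\mathbb R$ and $q\ge 0$. For any $x>d$, $$\lim_{n\to\infty}w_n^{(q)\prime}(x;d)=w^{(q)\prime}(x;d)\qquad\text{and}\qquad\lim_{n\to\infty}z_n^{(q)\prime}(x)=z^{(q)\prime}(x),$$ where $w^{(q)\prime}(\cdot;d)$ and $z^{(q)\prime}$ are the unique solutions of $$w^{(q)\prime}(x;d)=\Xi_\phi(x)^{-1}W^{(q)\prime}((x-d)+)+\int_d^x\Xi_\phi(x)^{-1}\phi(y)W^{(q)\prime}(x-y)\,w^{(q)\prime}(y;d)\,dy,$$ $$z^{(q)\prime}(x)=\Xi_\phi(x)^{-1}qW^{(q)}(x)+\int_0^x\Xi_\phi(x)^{-1}\phi(y)W^{(q)\prime}(x-y)\,z^{(q)\prime}(y)\,dy,$$ and $w_n^{(q)\prime}(\cdot;d)$, $z_n^{(q)\prime}$ are the unique solutions of the same two equations with $\phi$ replaced by $\phi_n$.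
   Context: $X$ is a spectrally negative Lévy process without monotone paths, with Laplace exponent $\psi(\lambda)=\gamma\lambda+\frac12\sigma^2\lambda^2+\int_0^\infty(e^{-\lambda z}-1+\lambda z\mathbf 1_{(0,1)}(z))\,\Pi(dz)$, $\lambda\ge0$. $X$ has bounded variation paths iff $\sigma=0$ and $\int_0^1z\,\Pi(dz)<\infty$; then $c:=\gamma+\int_0^1z\,\Pi(dz)$ is its drift. $W^{(q)}$ is the scale function of $X$: continuous on $[0,\infty)$ with $\int_0^\infty e^{-\lambda y}W^{(q)}(y)\,dy=1/(\psi(\lambda)-q)$ for all large $\lambda$, and $W^{(q)}(x)=0$ for $x<0$. $W^{(q)\prime}$ denotes the right derivative of $W^{(q)}$ on $(0,\infty)$ (also the meaning of $W^{(q)\prime}(x+)$). The rate function $\phi:\mathbb R\to\mathbb R$ is non-decreasing, $\phi(x)=0$ for $x\le d'$ for some fixed $d'\in\mathbb R$, and $\phi$ is either locally Lipschitz continuous or of the form $\sum_{j=1}^k\delta_j\mathbf 1_{\{x>b_j\}}$ with $\delta_j>0$, $b_1<\dots<b_k$; in the bounded variation case $\phi(x)<c$ for all $x$. For a rate function $\phi$, $\Xi_\phi(x)=1-W^{(q)}(0)\phi(x)$. An approximating sequence for $\phi$ is a sequence $(\phi_n)_{n\ge1}$ such that: (a) $\phi_n\to\phi$ uniformly on compact sets; (b) $\phi_1(x)\le\phi_2(x)\le\dots\le\phi(x)$ for all $x$; (c) for each $n$, $\phi_n(x)=\sum_{j=1}^{m_n}\delta_j^n\mathbf 1_{\{x>b_j^n\}}$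 for some $m_n\in\mathbb N$, real $b_1^n<\dots<b_{m_n}^n$ and $\delta_j^n>0$. Convention: $\int_0^x=0$ if $x<0$. Solutions of the Volterra equations are measurable functions for which the integrals are well defined; existence and uniqueness of solutions is known. *)

theory Defs
  imports "HOL-Probability.Probability"
begin

definition cadlag :: "(real \<Rightarrow> real) \<Rightarrow> bool" where
  "cadlag f \<longleftrightarrow> (\<forall>t\<ge>0. (f \<longlongrightarrow> f t) (at_right t)) \<and> (\<forall>t>0. \<exists>l. (f \<longlongrightarrow> l) (at_left t))"

definition levy_process :: "'a measure \<Rightarrow> (real \<Rightarrow> 'a \<Rightarrow> real) \<Rightarrow> bool" where
  "levy_process M X \<longleftrightarrow>
     prob_space M \<and>
     (\<forall>t\<ge>0. X t \<in> borel_measurable M) \<and>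
     (AE \<omega> in M. X 0 \<omega> = 0) \<and>
     (AE \<omega> in M. cadlag (\<lambda>t. X t \<omega>)) \<and>
     (\<forall>t (n::nat). 0 \<le> t 0 \<and> mono t \<longrightarrow>
        prob_space.indep_vars M (\<lambda>_. borel) (\<lambda>i \<omega>. X (t (Suc i)) \<omega> - X (t i) \<omega>) {..<n}) \<and>
     (\<forall>s\<ge>0. \<forall>h\<ge>0. distr M borel (\<lambda>\<omega>. X (s + h) \<omega> - X s \<omega>) = distr M borel (X h))"

definition no_positive_jumps :: "'a measure \<Rightarrow> (real \<Rightarrow> 'a \<Rightarrow> real) \<Rightarrow> bool" where
  "no_positive_jumps M X \<longleftrightarrow>
     (AE \<omega> in M. \<forall>t>0. \<forall>l. ((\<lambda>s. X s \<omega>) \<longlongrightarrow> l) (at_left t) \<longrightarrow> X t \<omega> \<le> l)"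

definition monotone_paths :: "'a measure \<Rightarrow> (real \<Rightarrow> 'a \<Rightarrow> real) \<Rightarrow> bool" where
  "monotone_paths M X \<longleftrightarrow>
     (AE \<omega> in M. mono_on {0..} (\<lambda>t. X t \<omega>)) \<or> (AE \<omega> in M. antimono_on {0..} (\<lambda>t. X t \<omega>))"

text \<open>The measure \<open>\<nu>\<close> lives on the positive half-line: it is the image of the
  L\'evy measure of \<open>X\<close> under \<open>z \<mapsto> - z\<close>.\<close>

definition levy_triplet :: "real \<Rightarrow> real measure \<Rightarrow> bool" where
  "levy_triplet \<sigma> \<nu> \<longleftrightarrow>
     0 \<le> \<sigma> \<and> sets \<nu> = sets borel \<and> emeasure \<nu> {..0} = 0 \<and> integrable \<nu> (\<lambda>z. min 1 (z\<^sup>2))"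

definition laplace_exponent :: "real \<Rightarrow> real \<Rightarrow> real measure \<Rightarrow> real \<Rightarrow> real" where
  "laplace_exponent \<gamma> \<sigma> \<nu> \<theta> =
     \<gamma> * \<theta> + \<sigma>\<^sup>2 * \<theta>\<^sup>2 / 2 +
     (LINT z|\<nu>. exp (- \<theta> * z) - 1 + \<theta> * z * indicator {0<..<1} z)"

definition spectrally_negative_levy ::
  "'a measure \<Rightarrow> (real \<Rightarrow> 'a \<Rightarrow> real) \<Rightarrow> real \<Rightarrow> real \<Rightarrow> real measure \<Rightarrow> bool" where
  "spectrally_negative_levy M X \<gamma> \<sigma> \<nu> \<longleftrightarrow>
     levy_process M X \<and> no_positive_jumps M X \<and> levy_triplet \<sigma> \<nu> \<and>
     (\<forall>t\<ge>0. \<forall>\<theta>\<ge>0. has_bochner_integral M (\<lambda>\<omega>. exp (\<theta> * X t \<omega>))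
                      (exp (t * laplace_exponent \<gamma> \<sigma> \<nu> \<theta>)))"

text \<open>Bounded variation of the paths is expressed through the triplet: the paths of a spectrally
  negative L\'evy process have bounded variation if and only if \<open>\<sigma> = 0\<close> and \<open>z\<close> is
  \<open>\<nu>\<close>-integrable near \<open>0\<close>.\<close>

definition bounded_variation_case :: "real \<Rightarrow> real measure \<Rightarrow> bool" where
  "bounded_variation_case \<sigma> \<nu> \<longleftrightarrow> \<sigma> = 0 \<and> set_integrable \<nu> {0<..<1} (\<lambda>z. z)"

definition levy_drift :: "real \<Rightarrow> real measure \<Rightarrow> real" where
  "levy_drift \<gamma> \<nu> = \<gamma> + (LINT z:{0<..<1}|\<nu>. z)"

definition scale_function ::
  "real \<Rightarrow> real \<Rightarrow> real measure \<Rightarrow> real \<Rightarrow> (real \<Rightarrow> real) \<Rightarrow> bool" where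
  "scale_function \<gamma> \<sigma> \<nu> q W \<longleftrightarrow>
     (\<forall>x<0. W x = 0) \<and> continuous_on {0..} W \<and>
     (\<forall>\<^sub>F \<theta> in at_top.
        set_integrable lborel {0..} (\<lambda>y. exp (- \<theta> * y) * W y) \<and>
        (LINT y:{0..}|lborel. exp (- \<theta> * y) * W y) = 1 / (laplace_exponent \<gamma> \<sigma> \<nu> \<theta> - q))"

text \<open>Only the values of \<open>W'\<close> on the open half-line matter; \<open>W' x\<close> is unconstrained for \<open>x \<le> 0\<close>.\<close>

definition right_derivative :: "(real \<Rightarrow> real) \<Rightarrow> (real \<Rightarrow> real) \<Rightarrow> bool" where
  "right_derivative W W' \<longleftrightarrow> (\<forall>x>0. (W has_real_derivative W' x) (at_right x))"

text \<open>The empty sum, that is the zero function, is allowed.\<close>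

definition step_rate :: "(real \<Rightarrow> real) \<Rightarrow> bool" where
  "step_rate \<phi> \<longleftrightarrow>
     (\<exists>(k::nat) \<delta> b. (\<forall>j\<in>{1..k}. 0 < \<delta> j) \<and> strict_mono_on {1..k} b \<and>
        (\<forall>x. \<phi> x = (\<Sum>j=1..k. \<delta> j * indicator {b j<..} x)))"

definition locally_lipschitz :: "(real \<Rightarrow> real) \<Rightarrow> bool" where
  "locally_lipschitz \<phi> \<longleftrightarrow> (\<forall>x. \<exists>r>0. \<exists>L. L-lipschitz_on (cball x r) \<phi>)"

definition rate_function :: "real \<Rightarrow> real \<Rightarrow> real measure \<Rightarrow> (real \<Rightarrow> real) \<Rightarrow> bool" where
  "rate_function \<gamma> \<sigma> \<nu> \<phi> \<longleftrightarrow>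
     mono \<phi> \<and> (\<exists>d'. \<forall>x\<le>d'. \<phi> x = 0) \<and>
     (locally_lipschitz \<phi> \<or> step_rate \<phi>) \<and>
     (bounded_variation_case \<sigma> \<nu> \<longrightarrow> (\<forall>x. \<phi> x < levy_drift \<gamma> \<nu>))"

text \<open>Sequences are indexed by \<open>n \<ge> 1\<close>; the entry at \<open>0\<close> is unconstrained.\<close>

definition approximating_sequence :: "(real \<Rightarrow> real) \<Rightarrow> (nat \<Rightarrow> real \<Rightarrow> real) \<Rightarrow> bool" where
  "approximating_sequence \<phi> \<phi>s \<longleftrightarrow>
     (\<forall>K. compact K \<longrightarrow> uniform_limit K \<phi>s \<phi> sequentially) \<and>
     (\<forall>n\<ge>1. \<forall>x. \<phi>s n x \<le> \<phi>s (Suc n) x \<and> \<phi>s n x \<le> \<phi> x) \<and>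
     (\<forall>n\<ge>1. step_rate (\<phi>s n))"

definition Xi :: "(real \<Rightarrow> real) \<Rightarrow> (real \<Rightarrow> real) \<Rightarrow> real \<Rightarrow> real" where
  "Xi W \<phi> x = 1 - W 0 * \<phi> x"

text \<open>Integrating over \<open>{a<..<x}\<close> makes the integral vanish for \<open>x \<le> a\<close> and never evaluates
  \<open>W'\<close> at \<open>0\<close>. Integrability is the requirement that the integrals be well defined.\<close>

definition w_solution ::
  "(real \<Rightarrow> real) \<Rightarrow> (real \<Rightarrow> real) \<Rightarrow> (real \<Rightarrow> real) \<Rightarrow> real \<Rightarrow> (real \<Rightarrow> real) \<Rightarrow> bool" where
  "w_solution W W' \<phi> d w \<longleftrightarrow>
     set_borel_measurable lborel {d<..} w \<and>
     (\<forall>x>d. set_integrable lborel {d<..<x} (\<lambda>y. inverse (Xi W \<phi> x) * \<phi> y * W' (x - y) * w y) \<and>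
        w x = inverse (Xi W \<phi> x) * W' (x - d) +
              (LINT y:{d<..<x}|lborel. inverse (Xi W \<phi> x) * \<phi> y * W' (x - y) * w y))"

definition z_solution ::
  "real \<Rightarrow> (real \<Rightarrow> real) \<Rightarrow> (real \<Rightarrow> real) \<Rightarrow> (real \<Rightarrow> real) \<Rightarrow> (real \<Rightarrow> real) \<Rightarrow> bool" where
  "z_solution q W W' \<phi> z \<longleftrightarrow>
     z \<in> borel_measurable lborel \<and>
     (\<forall>x. set_integrable lborel {0<..<x} (\<lambda>y. inverse (Xi W \<phi> x) * \<phi> y * W' (x - y) * z y) \<and>
        z x = inverse (Xi W \<phi> x) * (q * W x) +
              (LINT y:{0<..<x}|lborel. inverse (Xi W \<phi> x) * \<phi> y * W' (x - y) * z y))"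

end

theory Submission
  imports Defs
begin

text \<open>
  Both equations have the form \<open>u = c (h + K * (a u))\<close> with \<open>K = W' \<ge> 0\<close>, \<open>h \<ge> 0\<close>, \<open>a = \<phi>\<close> and
  \<open>c = 1 / \<Xi>\<close>. A nonnegative subsolution of the homogeneous equation vanishes, by a Gronwall argument
  that uses only finiteness of the convolution and integrability of \<open>K\<close> near 0. Hence
  solutions are nonnegative and increase with \<open>a\<close> and \<open>c\<close>, so the \<open>u\<^sub>n\<close> increase to a limit below
  \<open>u\<close>. By dominated convergence the limit solves the limit equation, so it is \<open>u\<close>.

  It remains to see that \<open>W\<close> is nondecreasing and that \<open>\<Xi> > 0\<close>. Put \<open>\<kappa>(\<lambda>) = (\<psi>(\<lambda>) - q) / \<lambda>\<close>. Its
  derivative is completely monotone, hence so is \<open>1 / \<kappa>\<close> where \<open>\<kappa> > 0\<close>. As \<open>1 / \<kappa>\<close> is the Laplace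
  transform of \<open>dW\<close>, the Post--Widder approximations of \<open>W\<close> are nondecreasing. Finally
  \<open>W(0) = lim 1 / \<kappa>\<close> at infinity, the reciprocal of the drift in the bounded variation case
  and 0 otherwise.
\<close>

subsection \<open>Homogeneous convolution inequalities\<close>

text \<open>A solution is only a measurable function whose integrals exist: local boundedness is not
  given, and no bound on \<open>W'\<close> near 0 is at hand, so neither iteration of the equation
  nor a supremum estimate can start. Integrability of a solution near a point has to be extracted
  from finiteness of its convolution with \<open>W'\<close>. The scale function in turn is given
  only by continuity and its Laplace transform, so facts that usually come from fluctuation
  identities, namely monotonicity and the value at 0, must be read off the transform. Dividing
  \<psi> - q by its argument makes this possible: the Gaussian part, the jump part and the part with
  q each contribute a completely monotone derivative. Post--Widder suits this because it uses only
  derivatives of the transform, so that their signs become an ordering of values.\<close>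

lemma nn_integral_conv_swap:
  fixes g K :: "real \<Rightarrow> ennreal"
  assumes [measurable]: "g \<in> borel_measurable borel" "K \<in> borel_measurable borel"
  shows "(\<integral>\<^sup>+ s. g (x - s) * K s \<partial>lborel) = (\<integral>\<^sup>+ y. g y * K (x - y) \<partial>lborel)"
  using nn_integral_real_affine[of "\<lambda>y. g y * K (x - y)" "-1" x] by simp

lemma nn_integral_shift:
  fixes f :: "real \<Rightarrow> ennreal"
  assumes [measurable]: "f \<in> borel_measurable borel"
  shows "(\<integral>\<^sup>+ x. f (t + x) \<partial>lborel) = (\<integral>\<^sup>+ x. f x \<partial>lborel)"
  using nn_integral_real_affine[of f 1 t] by simp

text \<open>Integrability of \<open>g\<close> follows from finiteness of the convolution at every point:
  the set where the convolution exceeds \<open>N\<close> has small measure for large \<open>N\<close>, and integrating the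
  convolution over the rest leaves a weight on \<open>g\<close> that is bounded below. Truncating \<open>K\<close> at 1 turns
  small measure into a small integral.\<close>

lemma convolution_integrable_near:
  fixes g K :: "real \<Rightarrow> ennreal"
  assumes [measurable]: "g \<in> borel_measurable borel" "K \<in> borel_measurable borel"
    and fin: "\<And>x. (\<integral>\<^sup>+ y. g y * K (x - y) \<partial>lborel) < \<infinity>"
    and pos: "(\<integral>\<^sup>+ s. min (K s) 1 * indicator {0<..<1} s \<partial>lborel) \<noteq> 0"
  shows "(\<integral>\<^sup>+ y. g y * indicator {t<..<t+1} y \<partial>lborel) < \<infinity>"
proof -
  define J where "J x = (\<integral>\<^sup>+ y. g y * K (x - y) \<partial>lborel)" for x
  have [measurable]: "J \<in> borel_measurable borel" unfolding J_def by measurable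
  define \<kappa> where "\<kappa> = (\<integral>\<^sup>+ s. min (K s) 1 * indicator {0<..<1} s \<partial>lborel)"
  have "\<kappa> \<le> (\<integral>\<^sup>+ s. indicator {0<..<1::real} s \<partial>lborel)"
    unfolding \<kappa>_def by (intro nn_integral_mono) (auto split: split_indicator)
  hence \<kappa>1: "\<kappa> < \<infinity>" by (simp add: order.strict_trans1)
  have \<kappa>0: "\<kappa> > 0" using pos by (simp add: \<kappa>_def zero_less_iff_neq_zero)
  \<comment> \<open>The window has length 2 because \<open>y + s\<close>, with \<open>y\<close> in
    \<open>{t<..<t+1}\<close> and \<open>s\<close> in \<open>{0<..<1}\<close>, must stay inside
    it.\<close>
  define C where "C N = {x\<in>{t<..<t+2}. of_nat N < J x}" for N :: nat
  have [measurable]: "C N \<in> sets borel" for N unfolding C_def by measurable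
  have "(\<lambda>N. emeasure lborel (C N)) \<longlonglongrightarrow> emeasure lborel (\<Inter>N. C N)"
  proof (rule Lim_emeasure_decseq)
    show "decseq C"
      by (auto simp: decseq_def C_def intro: le_less_trans[OF of_nat_mono])
    fix N
    have "emeasure lborel (C N) \<le> emeasure lborel {t<..<t+2}"
      by (intro emeasure_mono) (auto simp: C_def)
    thus "emeasure lborel (C N) \<noteq> \<infinity>" by (auto simp: top_unique)
  qed auto
  moreover have "(\<Inter>N. C N) = {}"
  proof -
    have False if "\<And>N. x \<in> C N" for x
    proof -
      have "J x < \<infinity>" using fin by (simp add: J_def)
      then obtain N where "J x < of_nat N" using ennreal_Ex_less_of_nat by auto
      thus False using that[of N] by (auto simp: C_def)
    qed
    thus ?thesis by blast
  qed
  ultimately have "(\<lambda>N. emeasure lborel (C N)) \<longlonglongrightarrow> 0" by simp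
  moreover have "\<kappa> / 2 > 0" using \<kappa>0 by (simp add: ennreal_zero_less_divide)
  ultimately have "eventually (\<lambda>N. emeasure lborel (C N) < \<kappa> / 2) sequentially"
    by (rule order_tendstoD)
  then obtain N where N: "emeasure lborel (C N) < \<kappa> / 2"
    by (auto simp: eventually_sequentially)
  define A where "A = {t<..<t+2} - C N"
  have [measurable]: "A \<in> sets borel" unfolding A_def by measurable
  have inner: "\<kappa> / 2 \<le> (\<integral>\<^sup>+ x. indicator A x * K (x - y) \<partial>lborel)" if y: "y \<in> {t<..<t+1}" for y
  proof -
    let ?m = "\<integral>\<^sup>+ s. indicator A (y + s) * K s \<partial>lborel"
    \<comment> \<open>Each such \<open>y + s\<close> lies in \<open>A\<close>, where the kernel is
      kept, or in \<open>C N\<close>, where its truncation is at most 1; the second share is below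
      half of \<kappa>.\<close>
    have "\<kappa> \<le> (\<integral>\<^sup>+ s. indicator A (y + s) * K s + indicator (C N) (y + s) \<partial>lborel)"
      unfolding \<kappa>_def
    proof (intro nn_integral_mono)
      fix s :: real
      show "min (K s) 1 * indicator {0<..<1} s \<le> indicator A (y + s) * K s + indicator (C N) (y + s)"
        using y by (auto split: split_indicator simp: A_def)
    qed
    also have "\<dots> = ?m + (\<integral>\<^sup>+ s. indicator (C N) (y + s) \<partial>lborel)"
      by (rule nn_integral_add) auto
    also have "(\<integral>\<^sup>+ s. indicator (C N) (y + s) \<partial>lborel) = emeasure lborel (C N)"
      by (subst nn_integral_shift) auto
    also have "?m + \<dots> \<le> ?m + \<kappa> / 2" using N by (intro add_left_mono) auto
    finally have le: "\<kappa> \<le> ?m + \<kappa> / 2" .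
    have "\<kappa> / 2 \<le> ?m"
    proof (cases "?m = top")
      case False
      then obtain m where m: "?m = ennreal m" "m \<ge> 0" by (cases ?m) auto
      obtain k where k: "\<kappa> = ennreal k" "k \<ge> 0" using \<kappa>1 by (cases \<kappa>) auto
      have k2: "\<kappa> / 2 = ennreal (k / 2)"
        unfolding k using k by (metis divide_ennreal ennreal_numeral zero_less_numeral zero_le_numeral)
      have "ennreal k \<le> ennreal m + ennreal (k / 2)"
        using le unfolding k2 m(1) unfolding k(1) .
      also have "\<dots> = ennreal (m + k / 2)" using k m by simp
      finally have "k \<le> m + k / 2" using k(2) m(2) by (simp only: ennreal_le_iff add_nonneg_nonneg divide_nonneg_pos zero_less_numeral)
      hence "k / 2 \<le> m" by simp
      thus ?thesis unfolding k2 m(1) by (rule ennreal_leI)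
    qed auto
    also have "?m = (\<integral>\<^sup>+ x. indicator A x * K (x - y) \<partial>lborel)"
      using nn_integral_shift[of "\<lambda>x. indicator A x * K (x - y)" y] by simp
    finally show ?thesis .
  qed
  have "(\<kappa> / 2) * (\<integral>\<^sup>+ y. g y * indicator {t<..<t+1} y \<partial>lborel)
      = (\<integral>\<^sup>+ y. (\<kappa> / 2) * (g y * indicator {t<..<t+1} y) \<partial>lborel)"
    by (subst nn_integral_cmult) auto
  also have "\<dots> \<le> (\<integral>\<^sup>+ y. (\<integral>\<^sup>+ x. indicator A x * (g y * K (x - y)) \<partial>lborel) \<partial>lborel)"
  proof (intro nn_integral_mono)
    fix y
    have "(\<kappa> / 2) * (g y * indicator {t<..<t+1} y) \<le> g y * (\<integral>\<^sup>+ x. indicator A x * K (x - y) \<partial>lborel)"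
      using inner[of y] by (auto split: split_indicator simp: mult.commute intro: mult_left_mono)
    also have "\<dots> = (\<integral>\<^sup>+ x. g y * (indicator A x * K (x - y)) \<partial>lborel)"
      by (subst nn_integral_cmult) auto
    finally show "(\<kappa> / 2) * (g y * indicator {t<..<t+1} y)
      \<le> (\<integral>\<^sup>+ x. indicator A x * (g y * K (x - y)) \<partial>lborel)" by (simp add: mult_ac)
  qed
  also have "\<dots> = (\<integral>\<^sup>+ x. (\<integral>\<^sup>+ y. indicator A x * (g y * K (x - y)) \<partial>lborel) \<partial>lborel)"
    by (rule lborel_pair.Fubini') measurable
  also have "\<dots> = (\<integral>\<^sup>+ x. indicator A x * J x \<partial>lborel)"
    unfolding J_def by (intro nn_integral_cong nn_integral_cmult) auto
  also have "\<dots> \<le> (\<integral>\<^sup>+ x. of_nat N * indicator {t<..<t+2} x \<partial>lborel)"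
    by (intro nn_integral_mono) (auto simp: A_def C_def split: split_indicator)
  also have "\<dots> = of_nat N * 2"
    by (subst nn_integral_cmult) auto
  also have "\<dots> < \<infinity>" by (simp add: ennreal_mult_less_top of_nat_less_top)
  finally have "\<kappa> / 2 * (\<integral>\<^sup>+ y. g y * indicator {t<..<t+1} y \<partial>lborel) < \<infinity>" .
  thus ?thesis using \<open>\<kappa> / 2 > 0\<close> by (auto simp: ennreal_mult_less_top)
qed

text \<open>If \<open>K\<close> vanishes a.e. near 0, the convolution at \<open>x\<close> only sees \<open>g\<close> at a distance from \<open>x\<close>;
  otherwise \<open>g\<close> is integrable near \<open>t\<close> and convolution with \<open>K\<close> is a contraction there.\<close>

lemma convolution_zero_step:
  fixes g K :: "real \<Rightarrow> ennreal"
  assumes [measurable]: "g \<in> borel_measurable borel" "K \<in> borel_measurable borel"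
    and fin: "\<And>x. (\<integral>\<^sup>+ y. g y * K (x - y) \<partial>lborel) < \<infinity>"
    and K0: "\<And>x. x \<le> 0 \<Longrightarrow> K x = 0"
    and Kint: "(\<integral>\<^sup>+ s. K s * indicator {0<..<1} s \<partial>lborel) < \<infinity>"
    and le: "\<And>x. x \<le> t + 1 \<Longrightarrow> g x \<le> ennreal B * (\<integral>\<^sup>+ y. g y * K (x - y) \<partial>lborel)"
    and g0: "\<And>x. x \<le> t \<Longrightarrow> g x = 0"
  shows "\<exists>\<eta>>0. \<forall>x<t+\<eta>. g x = 0"
proof (cases "(\<integral>\<^sup>+ s. min (K s) 1 * indicator {0<..<1} s \<partial>lborel) = 0")
  case True
  hence ae: "AE s in lborel. min (K s) 1 * indicator {0<..<1} s = 0"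
    by (subst (asm) nn_integral_0_iff_AE) auto
  have "g x = 0" if x: "x < t + 1" for x
  proof -
    have "(\<integral>\<^sup>+ y. g y * K (x - y) \<partial>lborel) = (\<integral>\<^sup>+ s. g (x - s) * K s \<partial>lborel)"
      by (rule nn_integral_conv_swap[symmetric]) auto
    \<comment> \<open>For \<open>s \<ge> 1\<close> the point \<open>x - s\<close> is still below
      \<open>t\<close>, where \<open>g\<close> vanishes; this is why a full step of length 1 is
      gained.\<close>
    also have "\<dots> = (\<integral>\<^sup>+ (s::real). 0 \<partial>lborel)"
    proof (intro nn_integral_cong_AE eventually_mono[OF ae])
      fix s :: real assume s: "min (K s) 1 * indicator {0<..<1} s = 0"
      show "g (x - s) * K s = 0"
      proof (cases "0 < s \<and> s < 1")
        case True
        hence "K s = 0" using s by (auto simp: min_def split: if_splits)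
        thus ?thesis by simp
      next
        case False
        thus ?thesis using K0[of s] g0[of "x - s"] x by (cases "s \<le> 0") auto
      qed
    qed
    finally show ?thesis using le[of x] x by simp
  qed
  thus ?thesis by (intro exI[of _ 1]) auto
next
  case False
  have Gfin: "(\<integral>\<^sup>+ y. g y * indicator {t<..<t+1} y \<partial>lborel) < \<infinity>"
    by (rule convolution_integrable_near[OF assms(1,2) fin False])
  \<comment> \<open>Continuity from above along intervals shrinking to the empty set yields \<eta>
    with \<open>B\<close> times the mass of \<open>K\<close> on (0, \<eta>) below 1/2, the
    contraction constant.\<close>
  define C where "C n = {0<..<1 / real (Suc n)}" for n
  have "(\<lambda>n. emeasure (density lborel K) (C n)) \<longlonglongrightarrow> emeasure (density lborel K) (\<Inter>n. C n)"
  proof (rule Lim_emeasure_decseq)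
    show "decseq C"
      unfolding decseq_def C_def
    proof (intro allI impI greaterThanLessThan_subseteq_greaterThanLessThan[THEN iffD2])
      fix m n :: nat assume "m \<le> n"
      thus "0 \<le> (0::real) \<and> 1 / real (Suc n) \<le> 1 / real (Suc m)"
        by (auto intro!: divide_left_mono)
    qed
    fix n
    have "emeasure (density lborel K) (C n) \<le> emeasure (density lborel K) {0<..<1}"
    proof (intro emeasure_mono)
      have "1 / real (Suc n) \<le> 1" by simp
      thus "C n \<subseteq> {0<..<1}" unfolding C_def by (intro greaterThanLessThan_subseteq_greaterThanLessThan[THEN iffD2]) auto
    qed auto
    also have "\<dots> < \<infinity>" using Kint by (subst emeasure_density) auto
    finally show "emeasure (density lborel K) (C n) \<noteq> \<infinity>" by simp
  qed (auto simp: C_def)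
  moreover have "(\<Inter>n. C n) = {}"
  proof -
    have False if "\<And>n. x \<in> C n" for x
    proof -
      have "x > 0" using that[of 0] by (auto simp: C_def)
      then obtain n where "inverse (real (Suc n)) < x" using reals_Archimedean by blast
      thus False using that[of n] by (auto simp: C_def inverse_eq_divide)
    qed
    thus ?thesis by blast
  qed
  ultimately have "(\<lambda>n. ennreal B * emeasure (density lborel K) (C n)) \<longlonglongrightarrow> ennreal B * 0"
    by (intro ennreal_tendsto_cmult) auto
  hence "eventually (\<lambda>n. ennreal B * emeasure (density lborel K) (C n) < ennreal (1/2)) sequentially"
    by (rule order_tendstoD) (subst mult_zero_right, subst ennreal_less_zero_iff, simp)
  then obtain n where n: "ennreal B * emeasure (density lborel K) (C n) < ennreal (1/2)"
    by (auto simp: eventually_sequentially)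
  define \<eta> where "\<eta> = 1 / real (Suc n)"
  have \<eta>: "0 < \<eta>" "\<eta> \<le> 1" by (auto simp: \<eta>_def)
  have BK: "ennreal B * (\<integral>\<^sup>+ s. K s * indicator {0<..<\<eta>} s \<partial>lborel) \<le> ennreal (1/2)"
    using n by (subst (asm) emeasure_density) (auto simp: C_def \<eta>_def)
  define G where "G = (\<integral>\<^sup>+ x. g x * indicator {t<..<t+\<eta>} x \<partial>lborel)"
  have "G \<le> (\<integral>\<^sup>+ y. g y * indicator {t<..<t+1} y \<partial>lborel)"
    unfolding G_def using \<eta> by (intro nn_integral_mono) (auto split: split_indicator)
  \<comment> \<open>Without finiteness, \<open>G \<le> G * (1/2)\<close> would allow
    \<open>G\<close> to be infinite; this is the use of the integrability just obtained.\<close>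
  hence Gf: "G < \<infinity>" using Gfin by (rule le_less_trans)
  have "G \<le> (\<integral>\<^sup>+ x. ennreal B * (\<integral>\<^sup>+ s. indicator {t<..<t+\<eta>} x * (g (x - s) * K s) \<partial>lborel) \<partial>lborel)"
    unfolding G_def
  proof (intro nn_integral_mono)
    fix x
    show "g x * indicator {t<..<t+\<eta>} x \<le>
      ennreal B * (\<integral>\<^sup>+ s. indicator {t<..<t+\<eta>} x * (g (x - s) * K s) \<partial>lborel)"
      using le[of x] \<eta> by (auto split: split_indicator simp: nn_integral_conv_swap)
  qed
  also have "\<dots> = ennreal B * (\<integral>\<^sup>+ x. (\<integral>\<^sup>+ s. indicator {t<..<t+\<eta>} x * (g (x - s) * K s) \<partial>lborel) \<partial>lborel)"
    by (subst nn_integral_cmult) auto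
  also have "(\<integral>\<^sup>+ x. (\<integral>\<^sup>+ s. indicator {t<..<t+\<eta>} x * (g (x - s) * K s) \<partial>lborel) \<partial>lborel)
      = (\<integral>\<^sup>+ s. (\<integral>\<^sup>+ x. indicator {t<..<t+\<eta>} x * (g (x - s) * K s) \<partial>lborel) \<partial>lborel)"
    by (rule lborel_pair.Fubini') measurable
  also have "\<dots> \<le> (\<integral>\<^sup>+ s. G * (K s * indicator {0<..<\<eta>} s) \<partial>lborel)"
  proof (intro nn_integral_mono)
    fix s :: real
    show "(\<integral>\<^sup>+ x. indicator {t<..<t+\<eta>} x * (g (x - s) * K s) \<partial>lborel) \<le> G * (K s * indicator {0<..<\<eta>} s)"
    proof (cases "0 < s \<and> s < \<eta>")
      case True
      have "(\<integral>\<^sup>+ x. indicator {t<..<t+\<eta>} x * (g (x - s) * K s) \<partial>lborel)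
         = (\<integral>\<^sup>+ x. indicator {t<..<t+\<eta>} (s + x) * (g x * K s) \<partial>lborel)"
        using nn_integral_shift[of "\<lambda>x. indicator {t<..<t+\<eta>} x * (g (x - s) * K s)" s] by simp
      also have "\<dots> \<le> (\<integral>\<^sup>+ x. (g x * indicator {t<..<t+\<eta>} x) * K s \<partial>lborel)"
        using True g0 by (intro nn_integral_mono) (force split: split_indicator)
      also have "\<dots> = G * K s" unfolding G_def by (rule nn_integral_multc) auto
      finally show ?thesis using True by simp
    next
      case False
      have "indicator {t<..<t+\<eta>} x * (g (x - s) * K s) = 0" for x
        using False K0[of s] g0[of "x - s"] by (cases "s \<le> 0") (auto split: split_indicator)
      hence "(\<integral>\<^sup>+ x. indicator {t<..<t+\<eta>} x * (g (x - s) * K s) \<partial>lborel) = 0" by (simp only: nn_integral_const mult_zero_left)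
      thus ?thesis by simp
    qed
  qed
  also have "\<dots> = G * (\<integral>\<^sup>+ s. K s * indicator {0<..<\<eta>} s \<partial>lborel)"
    by (rule nn_integral_cmult) auto
  finally have "G \<le> ennreal B * (G * (\<integral>\<^sup>+ s. K s * indicator {0<..<\<eta>} s \<partial>lborel))"
    by (simp add: mult_left_mono)
  also have "\<dots> = G * (ennreal B * (\<integral>\<^sup>+ s. K s * indicator {0<..<\<eta>} s \<partial>lborel))"
    by (simp add: mult_ac)
  also have "\<dots> \<le> G * ennreal (1/2)" using BK by (rule mult_left_mono) auto
  finally have "G \<le> G * ennreal (1/2)" .
  moreover obtain r where r: "G = ennreal r" "0 \<le> r" using Gf by (cases G) auto
  moreover have "ennreal r * ennreal (1/2) = ennreal (r * (1/2))"
    using r(2) by (intro ennreal_mult[symmetric]) auto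
  ultimately have "ennreal r \<le> ennreal (r * (1/2))" by (simp only:)
  hence "r \<le> r * (1/2)" using r(2) by (subst (asm) ennreal_le_iff) auto
  hence "G = 0" using r by simp
  hence ae: "AE x in lborel. g x * indicator {t<..<t+\<eta>} x = 0"
    unfolding G_def by (subst (asm) nn_integral_0_iff_AE) auto
  \<comment> \<open>From almost everywhere to everywhere: the right-hand side of \<open>le\<close>
    sees \<open>g\<close> only up to null sets.\<close>
  have "g x = 0" if x: "x < t + \<eta>" for x
  proof -
    have "(\<integral>\<^sup>+ y. g y * K (x - y) \<partial>lborel) = (\<integral>\<^sup>+ (y::real). 0 \<partial>lborel)"
    proof (intro nn_integral_cong_AE eventually_mono[OF ae])
      fix y assume "g y * indicator {t<..<t+\<eta>} y = 0"
      thus "g y * K (x - y) = 0"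
        using K0[of "x - y"] g0[of y] x by (cases "y \<ge> x") (auto split: split_indicator_asm)
    qed
    thus ?thesis using le[of x] x \<eta> by simp
  qed
  thus ?thesis using \<eta> by blast
qed

text \<open>The step length has no lower bound uniform in \<open>t\<close>, so the steps are not
  iterated. Instead \<open>t\<close> is the supremum of the points up to which \<open>g\<close>
  vanishes; the inequality at \<open>t\<close> uses only values to its left, so \<open>t\<close> is
  attained, and one more step contradicts maximality.\<close>

lemma convolution_zero:
  fixes g K :: "real \<Rightarrow> ennreal"
  assumes [measurable]: "g \<in> borel_measurable borel" "K \<in> borel_measurable borel"
    and fin: "\<And>x. (\<integral>\<^sup>+ y. g y * K (x - y) \<partial>lborel) < \<infinity>"
    and K0: "\<And>x. x \<le> 0 \<Longrightarrow> K x = 0"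
    and Kint: "(\<integral>\<^sup>+ s. K s * indicator {0<..<1} s \<partial>lborel) < \<infinity>"
    and le: "\<And>b. \<exists>B. \<forall>x\<le>b. g x \<le> ennreal B * (\<integral>\<^sup>+ y. g y * K (x - y) \<partial>lborel)"
    and g0: "\<And>x. x \<le> d \<Longrightarrow> g x = 0"
  shows "g x = 0"
proof (rule ccontr)
  assume nz: "g x \<noteq> 0"
  define S where "S = {t. \<forall>y\<le>t. g y = 0}"
  have dS: "d \<in> S" using g0 by (auto simp: S_def)
  have bdd: "bdd_above S"
  proof (rule bdd_aboveI)
    fix t assume "t \<in> S" thus "t \<le> x" using nz by (cases "x \<le> t") (auto simp: S_def)
  qed
  define t where "t = Sup S"
  have less: "g y = 0" if lt: "y < t" for y
  proof -
    obtain s where "s \<in> S" "y < s" using less_cSupE[of y S] lt dS unfolding t_def by (metis empty_iff)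
    thus ?thesis by (auto simp: S_def)
  qed
  obtain B where B: "\<And>y. y \<le> t + 1 \<Longrightarrow> g y \<le> ennreal B * (\<integral>\<^sup>+ u. g u * K (y - u) \<partial>lborel)"
    using le[of "t + 1"] by blast
  have "g t \<le> ennreal B * (\<integral>\<^sup>+ u. g u * K (t - u) \<partial>lborel)" using B[of t] by simp
  also have "(\<integral>\<^sup>+ u. g u * K (t - u) \<partial>lborel) = (\<integral>\<^sup>+ (u::real). 0 \<partial>lborel)"
  proof (intro nn_integral_cong)
    fix u show "g u * K (t - u) = 0" using less[of u] K0[of "t - u"] by (cases "u < t") auto
  qed
  finally have "g t = 0" by simp
  hence upto: "g y = 0" if "y \<le> t" for y using less that by (cases "y = t") auto
  obtain \<eta> where \<eta>: "\<eta> > 0" "\<And>y. y < t + \<eta> \<Longrightarrow> g y = 0"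
    using convolution_zero_step[OF assms(1,2) fin K0 Kint B upto] by blast
  have "t + \<eta> / 2 \<in> S" using \<eta> by (auto simp: S_def)
  hence "t + \<eta> / 2 \<le> t" unfolding t_def using bdd by (rule cSup_upper)
  thus False using \<eta> by simp
qed

subsection \<open>Comparison for Volterra equations\<close>

text \<open>With \<open>K\<close> zero on nonpositive arguments and solutions zero up to
  \<open>d\<close>, the integral from \<open>d\<close> to \<open>x\<close> becomes a convolution
  over the whole line, and no domains of integration have to be tracked.\<close>

locale volterra_kernel =
  fixes K :: "real \<Rightarrow> real" and h :: "real \<Rightarrow> real" and d :: real
  assumes K_measurable [measurable]: "K \<in> borel_measurable borel"
    and K_nonneg: "\<And>x. 0 \<le> K x"
    and K_nonpos_arg: "\<And>x. x \<le> 0 \<Longrightarrow> K x = 0"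
    and K_integrable: "(\<integral>\<^sup>+ s. ennreal (K s) * indicator {0<..<1} s \<partial>lborel) < \<infinity>"
    and h_nonneg: "\<And>x. x > d \<Longrightarrow> 0 \<le> h x"
begin

text \<open>Bounds on left half-lines are enough because only values up to \<open>x\<close> enter
  the equation at \<open>x\<close>; a nondecreasing rate may be unbounded to the right.\<close>

definition coeff :: "(real \<Rightarrow> real) \<Rightarrow> (real \<Rightarrow> real) \<Rightarrow> bool" where
  "coeff a c \<longleftrightarrow> a \<in> borel_measurable borel \<and> (\<forall>x. 0 \<le> a x \<and> 0 \<le> c x) \<and>
     (\<forall>b. \<exists>B. \<forall>x\<le>b. a x \<le> B \<and> c x \<le> B)"

definition sol :: "(real \<Rightarrow> real) \<Rightarrow> (real \<Rightarrow> real) \<Rightarrow> (real \<Rightarrow> real) \<Rightarrow> bool" where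
  "sol a c u \<longleftrightarrow> u \<in> borel_measurable borel \<and> (\<forall>x\<le>d. u x = 0) \<and>
     (\<forall>x. integrable lborel (\<lambda>y. a y * u y * K (x - y))) \<and>
     (\<forall>x>d. u x = c x * (h x + (LINT y|lborel. a y * u y * K (x - y))))"

lemma coeff_measurable: "coeff a c \<Longrightarrow> a \<in> borel_measurable borel"
  and coeff_nonneg: "coeff a c \<Longrightarrow> 0 \<le> a x" "coeff a c \<Longrightarrow> 0 \<le> c x"
  by (simp_all add: coeff_def)

text \<open>The vanishing criterion is applied to \<open>a * f\<close> rather than \<open>f\<close>,
  since only this product is known to have a finite convolution with \<open>K\<close>. The bound
  \<open>B\<close> on both coefficients enters twice, once for \<open>a\<close> and once for
  \<open>c\<close>.\<close>

lemma subsolution_zero: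
  assumes coeff: "coeff a c"
    and [measurable]: "f \<in> borel_measurable borel"
    and f_nonneg: "\<And>x. 0 \<le> f x"
    and f0: "\<And>x. x \<le> d \<Longrightarrow> f x = 0"
    and int: "\<And>x. integrable lborel (\<lambda>y. a y * f y * K (x - y))"
    and le: "\<And>x. x > d \<Longrightarrow> f x \<le> c x * (LINT y|lborel. a y * f y * K (x - y))"
  shows "f x = 0"
proof -
  note [measurable] = coeff_measurable[OF coeff] and a0 = coeff_nonneg(1)[OF coeff]
    and c0 = coeff_nonneg(2)[OF coeff]
  define g where "g y = ennreal (a y * f y)" for y
  have gK: "(\<integral>\<^sup>+ y. g y * ennreal (K (x - y)) \<partial>lborel) = ennreal (LINT y|lborel. a y * f y * K (x - y))" for x
  proof -
    have "(\<integral>\<^sup>+ y. g y * ennreal (K (x - y)) \<partial>lborel) = (\<integral>\<^sup>+ y. ennreal (a y * f y * K (x - y)) \<partial>lborel)"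
      using a0 f_nonneg K_nonneg by (auto simp: g_def ennreal_mult intro!: nn_integral_cong)
    also have "\<dots> = ennreal (LINT y|lborel. a y * f y * K (x - y))"
      using a0 f_nonneg K_nonneg int by (intro nn_integral_eq_integral) auto
    finally show ?thesis .
  qed
  have zero: "g y = 0" for y
  proof (rule convolution_zero[where K="\<lambda>x. ennreal (K x)" and d=d])
    show "g \<in> borel_measurable borel" unfolding g_def by measurable
    show "\<exists>B. \<forall>x\<le>b. g x \<le> ennreal B * (\<integral>\<^sup>+ y. g y * ennreal (K (x - y)) \<partial>lborel)" for b
    proof -
      obtain B where B: "\<And>x. x \<le> b \<Longrightarrow> a x \<le> B \<and> c x \<le> B"
        using coeff unfolding coeff_def by blast
      have "g x \<le> ennreal (B * B) * (\<integral>\<^sup>+ y. g y * ennreal (K (x - y)) \<partial>lborel)" if x: "x \<le> b" for x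
      proof (cases "x \<le> d")
        case True thus ?thesis by (simp add: g_def f0)
      next
        case False
        let ?I = "LINT y|lborel. a y * f y * K (x - y)"
        have I0: "0 \<le> ?I" using a0 f_nonneg K_nonneg by (intro integral_nonneg_AE) auto
        have B0: "0 \<le> B" using B[OF x] a0[of x] by linarith
        have "a x * f x \<le> B * (B * ?I)"
        proof (intro mult_mono)
          have "f x \<le> c x * ?I" using le False by auto
          also have "\<dots> \<le> B * ?I" using B[OF x] I0 by (intro mult_right_mono) auto
          finally show "f x \<le> B * ?I" .
        qed (use B[OF x] B0 f_nonneg in auto)
        thus ?thesis unfolding gK using I0 B0
          by (simp add: g_def ennreal_mult[symmetric] mult.assoc ennreal_leI)
      qed
      thus ?thesis by blast
    qed
    show "(\<integral>\<^sup>+ y. g y * ennreal (K (x - y)) \<partial>lborel) < \<infinity>" for x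
      unfolding gK by simp
    show "(\<integral>\<^sup>+ s. ennreal (K s) * indicator {0<..<1} s \<partial>lborel) < \<infinity>"
      by (rule K_integrable)
  qed (auto simp: g_def f0 K_nonpos_arg)
  show ?thesis
  proof (cases "x \<le> d")
    case False
    \<comment> \<open>Where \<open>a\<close> is zero this says nothing about \<open>f\<close>, but
      it kills the integral that bounds \<open>f\<close>.\<close>
    have af: "a y * f y = 0" for y using zero[of y] a0[of y] f_nonneg[of y]
      by (metis antisym ennreal_eq_0_iff g_def mult_nonneg_nonneg)
    have "f x \<le> 0" using le[of x] False unfolding af by simp
    thus ?thesis using f_nonneg[of x] by simp
  qed (simp add: f0)
qed

lemma sol_measurable: "sol a c u \<Longrightarrow> u \<in> borel_measurable borel"
  and sol_left: "sol a c u \<Longrightarrow> x \<le> d \<Longrightarrow> u x = 0"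
  and sol_integrable: "sol a c u \<Longrightarrow> integrable lborel (\<lambda>y. a y * u y * K (x - y))"
  and sol_eq: "sol a c u \<Longrightarrow> x > d \<Longrightarrow> u x = c x * (h x + (LINT y|lborel. a y * u y * K (x - y)))"
  by (auto simp: sol_def)

text \<open>The negative part of \<open>u\<close> is a subsolution of the homogeneous equation:
  dropping the nonnegative \<open>h\<close> only weakens the inequality.\<close>

lemma sol_nonneg:
  assumes coeff: "coeff a c" and sol: "sol a c u"
  shows "0 \<le> u x"
proof -
  note [measurable] = sol_measurable[OF sol]
  note [measurable] = coeff_measurable[OF coeff] and a0 = coeff_nonneg(1)[OF coeff]
    and c0 = coeff_nonneg(2)[OF coeff]
  define f where "f y = max 0 (- u y)" for y
  have [measurable]: "f \<in> borel_measurable borel" unfolding f_def by measurable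
  have f_int: "integrable lborel (\<lambda>y. a y * f y * K (x - y))" for x
  proof (rule Bochner_Integration.integrable_bound[OF sol_integrable[OF sol, of x]])
    have "\<bar>f y\<bar> \<le> \<bar>u y\<bar>" for y by (auto simp: f_def)
    thus "AE y in lborel. norm (a y * f y * K (x - y)) \<le> norm (a y * u y * K (x - y))"
      by (intro AE_I2) (simp add: abs_mult mult_left_mono mult_right_mono)
  qed simp
  have "f x = 0"
  proof (rule subsolution_zero[where f=f and x=x, OF coeff])
    fix x assume x: "x > d"
    have I0: "0 \<le> (LINT y|lborel. a y * f y * K (x - y))"
      using a0 K_nonneg by (intro integral_nonneg_AE) (auto simp: f_def)
    have "- (LINT y|lborel. a y * f y * K (x - y)) = (LINT y|lborel. - (a y * f y * K (x - y)))" by simp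
    also have "\<dots> \<le> (LINT y|lborel. a y * u y * K (x - y))"
    proof (rule integral_mono)
      show "- (a y * f y * K (x - y)) \<le> a y * u y * K (x - y)" for y
      proof -
        have "a y * (- f y) * K (x - y) \<le> a y * u y * K (x - y)"
          using a0 K_nonneg by (intro mult_right_mono mult_left_mono) (auto simp: f_def)
        thus ?thesis by simp
      qed
      show "integrable lborel (\<lambda>y. - (a y * f y * K (x - y)))"
        by (rule Bochner_Integration.integrable_minus) (rule f_int)
      show "integrable lborel (\<lambda>y. a y * u y * K (x - y))" by (rule sol_integrable[OF sol])
    qed
    also have "\<dots> \<le> h x + \<dots>" using h_nonneg[OF x] by simp
    finally have "c x * (- (LINT y|lborel. a y * f y * K (x - y))) \<le> u x"
      unfolding sol_eq[OF sol x] using c0 by (rule mult_left_mono)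
    moreover have "0 \<le> c x * (LINT y|lborel. a y * f y * K (x - y))" using I0 c0 by simp
    ultimately show "f x \<le> c x * (LINT y|lborel. a y * f y * K (x - y))"
      by (auto simp: f_def)
  next
    show "f y = 0" if "y \<le> d" for y using sol_left[OF sol that] by (simp add: f_def)
    show "0 \<le> f y" for y by (simp add: f_def)
    show "integrable lborel (\<lambda>y. a y * f y * K (x - y))" for x by (rule f_int)
    show "f \<in> borel_measurable borel" by fact
  qed
  thus ?thesis by (simp add: f_def)
qed

text \<open>The positive part \<open>f\<close> of \<open>u - u'\<close> is a subsolution for the
  smaller coefficients, as \<open>a * u \<le> a' * u' + a * f\<close>. Nonnegativity of
  \<open>u'\<close> is needed twice: for this inequality, and for \<open>f \<le> u\<close>, which
  makes the convolution of \<open>f\<close> finite.\<close>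

lemma sol_mono:
  assumes coeff: "coeff a c" "coeff a' c'" and sol: "sol a c u" "sol a' c' u'"
    and le: "\<And>x. a x \<le> a' x" "\<And>x. c x \<le> c' x"
  shows "u x \<le> u' x"
proof -
  note [measurable] = sol(1)[THEN sol_measurable] sol(2)[THEN sol_measurable]
  note [measurable] = coeff_measurable[OF coeff(1)] and a0 = coeff_nonneg(1)[OF coeff(1)]
    and c0 = coeff_nonneg(2)[OF coeff(1)]
  note u0 = sol_nonneg[OF coeff(1) sol(1)] and u'0 = sol_nonneg[OF coeff(2) sol(2)]
  define f where "f y = max 0 (u y - u' y)" for y
  have [measurable]: "f \<in> borel_measurable borel" unfolding f_def by measurable
  have f_int: "integrable lborel (\<lambda>y. a y * f y * K (x - y))" for x
  proof (rule Bochner_Integration.integrable_bound[OF sol_integrable[OF sol(1), of x]])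
    have "\<bar>f y\<bar> \<le> \<bar>u y\<bar>" for y using u0[of y] u'0[of y] by (auto simp: f_def)
    thus "AE y in lborel. norm (a y * f y * K (x - y)) \<le> norm (a y * u y * K (x - y))"
      by (intro AE_I2) (simp add: abs_mult mult_left_mono mult_right_mono)
  qed simp
  have "f x = 0"
  proof (rule subsolution_zero[where f=f and x=x, OF coeff(1)])
    fix x assume x: "x > d"
    let ?F = "LINT y|lborel. a y * f y * K (x - y)"
    let ?U = "LINT y|lborel. a y * u y * K (x - y)"
    let ?U' = "LINT y|lborel. a' y * u' y * K (x - y)"
    have F0: "0 \<le> ?F" and U'0: "0 \<le> ?U'"
      using a0 K_nonneg u'0 order_trans[OF a0 le(1)] by (auto intro!: integral_nonneg_AE simp: f_def)
    have "?U \<le> (LINT y|lborel. a' y * u' y * K (x - y) + a y * f y * K (x - y))"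
    proof (rule integral_mono)
      show "a y * u y * K (x - y) \<le> a' y * u' y * K (x - y) + a y * f y * K (x - y)" for y
      proof -
        have "a y * u y \<le> a y * (u' y + f y)" using a0 by (intro mult_left_mono) (auto simp: f_def)
        also have "\<dots> \<le> a' y * u' y + a y * f y"
          using mult_right_mono[OF le(1) u'0, of y y] by (simp add: algebra_simps)
        finally show ?thesis
          using mult_right_mono[of "a y * u y" "a' y * u' y + a y * f y" "K (x - y)"] K_nonneg
          by (simp add: distrib_right)
      qed
      show "integrable lborel (\<lambda>y. a' y * u' y * K (x - y) + a y * f y * K (x - y))"
        by (intro Bochner_Integration.integrable_add f_int sol(2)[THEN sol_integrable])
      show "integrable lborel (\<lambda>y. a y * u y * K (x - y))" by (rule sol(1)[THEN sol_integrable])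
    qed
    also have "\<dots> = ?U' + ?F"
      using f_int sol(2)[THEN sol_integrable] by (rule Bochner_Integration.integral_add[rotated])
    finally have "u x \<le> c x * (h x + ?U' + ?F)"
      unfolding sol_eq[OF sol(1) x] using c0 by (intro mult_left_mono) auto
    also have "\<dots> \<le> u' x + c x * ?F"
      unfolding sol_eq[OF sol(2) x] using mult_right_mono[OF le(2), of "h x + ?U'" x] h_nonneg[OF x] U'0
      by (simp add: algebra_simps)
    finally show "f x \<le> c x * ?F" using F0 c0 by (auto simp: f_def)
  next
    show "f y = 0" if "y \<le> d" for y
      using sol(1)[THEN sol_left, OF that] sol(2)[THEN sol_left, OF that] by (simp add: f_def)
    show "0 \<le> f y" for y by (simp add: f_def)
    show "integrable lborel (\<lambda>y. a y * f y * K (x - y))" for x by (rule f_int)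
    show "f \<in> borel_measurable borel" by fact
  qed
  thus ?thesis by (simp add: f_def)
qed

text \<open>The limit solution supplies the dominating function
  \<open>a y * u y * K (x - y)\<close>, integrable because \<open>u\<close> solves its equation; no
  estimate uniform in \<open>n\<close> is required.\<close>

theorem sol_tendsto:
  assumes coeff: "coeff a c" "\<And>n. coeff (as n) (cs n)"
    and sol: "sol a c u" "\<And>n. sol (as n) (cs n) (us n)"
    and mono: "\<And>n x. as n x \<le> as (Suc n) x" "\<And>n x. cs n x \<le> cs (Suc n) x"
    and le: "\<And>n x. as n x \<le> a x" "\<And>n x. cs n x \<le> c x"
    and lim: "\<And>x. (\<lambda>n. as n x) \<longlonglongrightarrow> a x" "\<And>x. (\<lambda>n. cs n x) \<longlonglongrightarrow> c x"
  shows "(\<lambda>n. us n x) \<longlonglongrightarrow> u x"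
proof -
  note [measurable] = sol(1)[THEN sol_measurable] sol(2)[THEN sol_measurable]
  note [measurable] = coeff(1)[THEN coeff_measurable] coeff(2)[THEN coeff_measurable]
  note a0 = coeff(1)[THEN coeff_nonneg(1)] and an0 = coeff(2)[THEN coeff_nonneg(1)]
  note u0 = sol_nonneg[OF coeff(1) sol(1)] and un0 = sol_nonneg[OF coeff(2) sol(2)]
  have le_u: "us n x \<le> u x" for n x
    by (rule sol_mono[OF coeff(2,1) sol(2,1) le])
  have inc: "incseq (\<lambda>n. us n x)" for x
    by (rule incseq_SucI) (rule sol_mono[OF coeff(2,2) sol(2,2) mono])
  define v where "v x = lim (\<lambda>n. us n x)" for x
  have v: "(\<lambda>n. us n x) \<longlonglongrightarrow> v x" for x
  proof (rule incseq_convergent[OF inc])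
    show "\<forall>n. us n x \<le> u x" using le_u by simp
  qed (simp add: v_def limI)
  have [measurable]: "v \<in> borel_measurable borel"
    by (rule borel_measurable_LIMSEQ_real[OF v]) simp
  have dom: "norm (as n y * us n y * K (x - y)) \<le> a y * u y * K (x - y)" for n x y
  proof -
    have "norm (as n y * us n y * K (x - y)) = as n y * us n y * K (x - y)"
      using an0 un0 K_nonneg by simp
    also have "\<dots> \<le> a y * u y * K (x - y)"
      by (intro mult_right_mono mult_mono le le_u a0 un0 K_nonneg)
    finally show ?thesis .
  qed
  have lim_int: "(\<lambda>n. LINT y|lborel. as n y * us n y * K (x - y)) \<longlonglongrightarrow> (LINT y|lborel. a y * v y * K (x - y))"
    and v_int: "integrable lborel (\<lambda>y. a y * v y * K (x - y))" for x
  proof -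
    have ae: "AE y in lborel. (\<lambda>n. as n y * us n y * K (x - y)) \<longlonglongrightarrow> a y * v y * K (x - y)"
      by (intro AE_I2 tendsto_mult tendsto_const v lim)
    have ae2: "AE y in lborel. norm (as n y * us n y * K (x - y)) \<le> a y * u y * K (x - y)" for n
      using dom by simp
    show "(\<lambda>n. LINT y|lborel. as n y * us n y * K (x - y)) \<longlonglongrightarrow> (LINT y|lborel. a y * v y * K (x - y))"
      by (rule integral_dominated_convergence[OF _ _ sol_integrable[OF sol(1)] ae ae2]) auto
    show "integrable lborel (\<lambda>y. a y * v y * K (x - y))"
      by (rule integrable_dominated_convergence[OF _ _ sol_integrable[OF sol(1)] ae ae2]) auto
  qed
  have v_eq: "v x = c x * (h x + (LINT y|lborel. a y * v y * K (x - y)))" if x: "x > d" for x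
  proof (rule LIMSEQ_unique[OF v])
    have "(\<lambda>n. cs n x * (h x + (LINT y|lborel. as n y * us n y * K (x - y))))
       \<longlonglongrightarrow> c x * (h x + (LINT y|lborel. a y * v y * K (x - y)))"
      by (intro tendsto_intros lim lim_int)
    thus "(\<lambda>n. us n x) \<longlonglongrightarrow> c x * (h x + (LINT y|lborel. a y * v y * K (x - y)))"
      using sol_eq[OF sol(2) x] by simp
  qed
  have "v x = 0" if "x \<le> d" for x
    using v[of x] sol_left[OF sol(2) that] by (simp add: LIMSEQ_const_iff)
  hence "sol a c v" unfolding sol_def using v_int v_eq by simp
  \<comment> \<open>Uniqueness is comparison in both directions with equal coefficients.\<close>
  hence "u x = v x"
    using sol_mono[OF coeff(1,1) sol(1) _ order_refl order_refl, of v x]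
      sol_mono[OF coeff(1,1) _ sol(1) order_refl order_refl, of v x] by simp
  thus ?thesis using v by simp
qed

end

subsection \<open>Differentiation under the integral\<close>

text \<open>Monotonicity of \<open>f\<close> in \<open>l\<close> replaces a separate dominating
  function. By the mean value theorem a difference quotient of \<open>g\<close> to the left of
  \<open>l\<close> dominates \<open>f l\<close>, which gives integrability; then
  \<open>f (l - \<delta>)\<close> dominates all difference quotients taken within \<delta> of
  \<open>l\<close>.\<close>

lemma LINT_parametric_derivative:
  fixes g f :: "real \<Rightarrow> 'a \<Rightarrow> real"
  assumes int: "\<And>l. l > a \<Longrightarrow> integrable M (g l)"
    and der: "\<And>l z. l > a \<Longrightarrow> z \<in> space M \<Longrightarrow> ((\<lambda>l. g l z) has_real_derivative - f l z) (at l)"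
    and nonneg: "\<And>l z. l > a \<Longrightarrow> z \<in> space M \<Longrightarrow> 0 \<le> f l z"
    and anti: "\<And>l l' z. a < l \<Longrightarrow> l \<le> l' \<Longrightarrow> z \<in> space M \<Longrightarrow> f l' z \<le> f l z"
    and l: "l > a"
  shows "integrable M (f l)"
    and "((\<lambda>l. LINT z|M. g l z) has_real_derivative - (LINT z|M. f l z)) (at l)"
proof -
  have MV: "\<exists>\<xi>. p < \<xi> \<and> \<xi> < r \<and> g r z - g p z = - ((r - p) * f \<xi> z)"
    if "a < p" "p < r" "z \<in> space M" for p r z
    using MVT2[OF that(2), of "\<lambda>l. g l z" "\<lambda>l. - f l z"] der that by auto
  have f_int: "integrable M (f l)" if l: "l > a" for l
  proof -
    define \<delta> where "\<delta> = (l - a) / 2"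
    have \<delta>: "\<delta> > 0" "l - \<delta> > a" using l by (auto simp: \<delta>_def field_simps)
    have g_meas: "g r \<in> borel_measurable M" if "r > a" for r
      using int[OF that] by (rule borel_measurable_integrable)
    have meas: "f l \<in> borel_measurable M"
    \<comment> \<open>Measurability of \<open>f l\<close> is not assumed; it is a pointwise limit of
      difference quotients of \<open>g\<close>.\<close>
    proof (rule borel_measurable_LIMSEQ_real)
      fix z assume z: "z \<in> space M"
      have "((\<lambda>h. (g (l + h) z - g l z) / h) \<longlongrightarrow> - f l z) (at 0)"
        using der[OF l z] by (simp add: DERIV_def)
      moreover have "filterlim (\<lambda>n. inverse (real (Suc n))) (at 0) sequentially"
        by (intro filterlim_atI LIMSEQ_inverse_real_of_nat) auto
      ultimately have "(\<lambda>n. (g (l + inverse (real (Suc n))) z - g l z) / inverse (real (Suc n))) \<longlonglongrightarrow> - f l z"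
        by (rule filterlim_compose)
      from tendsto_minus[OF this]
      show "(\<lambda>n. - ((g (l + inverse (real (Suc n))) z - g l z) / inverse (real (Suc n)))) \<longlonglongrightarrow> f l z" by simp
    next
      fix n
      have "l + inverse (real (Suc n)) > a"
        using l add_pos_pos[of "l - a" "inverse (real (Suc n))"] by simp
      from g_meas[OF this] g_meas[OF l]
      show "(\<lambda>z. - ((g (l + inverse (real (Suc n))) z - g l z) / inverse (real (Suc n)))) \<in> borel_measurable M"
        by measurable
    qed
    show ?thesis
    proof (rule Bochner_Integration.integrable_bound)
      show "integrable M (\<lambda>z. (g (l - \<delta>) z - g l z) / \<delta>)" using int \<delta> l by simp
      show "AE z in M. norm (f l z) \<le> norm ((g (l - \<delta>) z - g l z) / \<delta>)"
      proof (rule AE_I2)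
        fix z assume z: "z \<in> space M"
        obtain \<xi> where \<xi>: "l - \<delta> < \<xi>" "\<xi> < l" "g l z - g (l - \<delta>) z = - (\<delta> * f \<xi> z)"
          using MV[OF \<delta>(2) _ z, of l] \<delta> by auto
        have "f l z \<le> f \<xi> z" using anti[of \<xi> l z] \<xi> \<delta> z by simp
        moreover have "f \<xi> z = (g (l - \<delta>) z - g l z) / \<delta>" using \<xi> \<delta> by (simp add: field_simps)
        ultimately have "f l z \<le> \<bar>(g (l - \<delta>) z - g l z) / \<delta>\<bar>"
          by linarith
        thus "norm (f l z) \<le> norm ((g (l - \<delta>) z - g l z) / \<delta>)"
          using nonneg[OF l z] by (simp only: real_norm_def abs_of_nonneg)
      qed
    qed (rule meas)
  qed
  show "integrable M (f l)" by (rule f_int[OF l])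
  define \<delta> where "\<delta> = (l - a) / 2"
  have \<delta>: "\<delta> > 0" "l - \<delta> > a" using l by (auto simp: \<delta>_def field_simps)
  have "((\<lambda>h. ((LINT z|M. g (l + h) z) - (LINT z|M. g l z)) / h) \<longlongrightarrow> - (LINT z|M. f l z)) (at 0)"
  proof (subst LIMSEQ_SEQ_conv[symmetric], intro allI impI)
    fix S :: "nat \<Rightarrow> real" assume S: "(\<forall>n. S n \<noteq> 0) \<and> S \<longlonglongrightarrow> 0"
    have "eventually (\<lambda>n. \<bar>S n\<bar> < \<delta>) sequentially"
      using order_tendstoD(2)[OF tendsto_rabs[of S 0 sequentially], of \<delta>] S \<delta> by simp
    then obtain N where N: "\<And>n. n \<ge> N \<Longrightarrow> \<bar>S n\<bar> < \<delta>" by (auto simp: eventually_sequentially)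
    define T where "T n = S (n + N)" for n
    have T: "T n \<noteq> 0" "\<bar>T n\<bar> < \<delta>" "l + T n > a" for n
      using S N[of "n + N"] \<delta> by (auto simp: T_def abs_less_iff)
    have T0: "filterlim T (at 0) sequentially"
      using S T unfolding T_def by (intro filterlim_atI LIMSEQ_ignore_initial_segment) auto
    have "(\<lambda>n. LINT z|M. (g (l + T n) z - g l z) / T n) \<longlonglongrightarrow> (LINT z|M. - f l z)"
    proof (rule integral_dominated_convergence)
      show "(\<lambda>z. - f l z) \<in> borel_measurable M"
        using borel_measurable_integrable[OF f_int[OF l]] by simp
      show "(\<lambda>z. (g (l + T n) z - g l z) / T n) \<in> borel_measurable M" for n
        using int[OF T(3)] int[OF l] by (intro borel_measurable_integrable) simp
      show "integrable M (f (l - \<delta>))" by (rule f_int[OF \<delta>(2)])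
      show "AE z in M. (\<lambda>n. (g (l + T n) z - g l z) / T n) \<longlonglongrightarrow> - f l z"
      proof (rule AE_I2)
        fix z assume z: "z \<in> space M"
        have "((\<lambda>h. (g (l + h) z - g l z) / h) \<longlongrightarrow> - f l z) (at 0)"
          using der[OF l z] by (simp add: DERIV_def)
        thus "(\<lambda>n. (g (l + T n) z - g l z) / T n) \<longlonglongrightarrow> - f l z"
          using T0 by (rule filterlim_compose)
      qed
      show "AE z in M. norm ((g (l + T n) z - g l z) / T n) \<le> f (l - \<delta>) z" for n
      proof (rule AE_I2)
        fix z assume z: "z \<in> space M"
        have "\<exists>\<xi>>l - \<delta>. (g (l + T n) z - g l z) / T n = - f \<xi> z"
        proof (cases "T n > 0")
          case True
          then obtain \<xi> where "l < \<xi>" "g (l + T n) z - g l z = - (T n * f \<xi> z)"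
            using MV[OF l _ z, of "l + T n"] by auto
          thus ?thesis using True \<delta> by (intro exI[of _ \<xi>]) simp
        next
          case False
          hence "T n < 0" using T(1)[of n] by simp
          then obtain \<xi> where "l + T n < \<xi>" "g l z - g (l + T n) z = T n * f \<xi> z"
            using MV[OF T(3) _ z, of n l] by auto
          hence "g (l + T n) z - g l z = - (T n * f \<xi> z)" by simp
          thus ?thesis using T(1,2)[of n] \<open>l + T n < \<xi>\<close> by (intro exI[of _ \<xi>]) auto
        qed
        then obtain \<xi> where \<xi>: "\<xi> > l - \<delta>" "(g (l + T n) z - g l z) / T n = - f \<xi> z" by blast
        thus "norm ((g (l + T n) z - g l z) / T n) \<le> f (l - \<delta>) z"
          using nonneg[of \<xi> z] anti[of "l - \<delta>" \<xi> z] \<delta> z by simp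
      qed
    qed
    also have "(\<lambda>n. LINT z|M. (g (l + T n) z - g l z) / T n)
        = (\<lambda>n. ((LINT z|M. g (l + T n) z) - (LINT z|M. g l z)) / T n)"
      using int[OF T(3)] int[OF l] by simp
    finally have "(\<lambda>n. ((LINT z|M. g (l + S (n + N)) z) - (LINT z|M. g l z)) / S (n + N))
        \<longlonglongrightarrow> - (LINT z|M. f l z)" by (simp add: T_def)
    thus "(\<lambda>n. ((LINT z|M. g (l + S n) z) - (LINT z|M. g l z)) / S n) \<longlonglongrightarrow> - (LINT z|M. f l z)"
      by (rule LIMSEQ_offset)
  qed
  thus "((\<lambda>l. LINT z|M. g l z) has_real_derivative - (LINT z|M. f l z)) (at l)"
    by (simp add: DERIV_def)
qed

subsection \<open>Completely monotone functions\<close>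

text \<open>The condition that \<open>(-1)^k\<close> times the k-th derivative is nonnegative on
  \<open>{a<..}\<close> for all k up to \<open>n\<close>; holding for every \<open>n\<close>, it is
  complete monotonicity. The sign is absorbed into each derivative, and the finite order permits
  induction on \<open>n\<close> for products and reciprocals.\<close>

primrec alternating :: "real \<Rightarrow> nat \<Rightarrow> (real \<Rightarrow> real) \<Rightarrow> bool" where
  "alternating a 0 f \<longleftrightarrow> (\<forall>l>a. 0 \<le> f l)"
| "alternating a (Suc n) f \<longleftrightarrow> (\<forall>l>a. 0 \<le> f l) \<and>
     (\<exists>g. (\<forall>l>a. (f has_real_derivative - g l) (at l)) \<and> alternating a n g)"

lemma alternating_nonneg: "alternating a n f \<Longrightarrow> l > a \<Longrightarrow> 0 \<le> f l"
  by (cases n) auto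

lemma alternating_SucI:
  assumes "\<And>l. l > a \<Longrightarrow> 0 \<le> f l" "\<And>l. l > a \<Longrightarrow> (f has_real_derivative - g l) (at l)" "alternating a n g"
  shows "alternating a (Suc n) f"
  unfolding alternating.simps using assms by (intro conjI exI[of _ g] allI impI) simp_all

lemma alternating_SucE:
  assumes "alternating a (Suc n) f"
  obtains g where "\<And>l. l > a \<Longrightarrow> (f has_real_derivative - g l) (at l)" "alternating a n g"
proof -
  obtain g where "(\<forall>l>a. (f has_real_derivative - g l) (at l)) \<and> alternating a n g"
    using assms unfolding alternating.simps(2) by (elim conjE exE) (rule that; simp)
  thus thesis by (intro that[of g]) simp_all
qed

lemma alternating_Suc: "alternating a (Suc n) f \<Longrightarrow> alternating a n f"
proof (induction n arbitrary: f)
  case (Suc n)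
  from Suc.prems obtain g where g: "\<And>l. l > a \<Longrightarrow> (f has_real_derivative - g l) (at l)" "alternating a (Suc n) g"
    by (rule alternating_SucE) (rule that; simp)
  show ?case by (rule alternating_SucI[OF alternating_nonneg[OF Suc.prems] g(1) Suc.IH[OF g(2)]])
qed simp

lemma alternating_const: "0 \<le> c \<Longrightarrow> alternating a n (\<lambda>_. c)"
proof (induction n arbitrary: c)
  case (Suc n)
  show ?case
    by (rule alternating_SucI[where g="\<lambda>_. 0"]) (use Suc.IH[of 0] Suc.prems in simp_all)
qed simp

lemma alternating_add: "alternating a n f \<Longrightarrow> alternating a n g \<Longrightarrow> alternating a n (\<lambda>l. f l + g l)"
proof (induction n arbitrary: f g)
  case (Suc n)
  obtain f' where f': "\<And>l. l > a \<Longrightarrow> (f has_real_derivative - f' l) (at l)" "alternating a n f'"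
    using Suc.prems(1) by (rule alternating_SucE) (rule that; simp)
  obtain g' where g': "\<And>l. l > a \<Longrightarrow> (g has_real_derivative - g' l) (at l)" "alternating a n g'"
    using Suc.prems(2) by (rule alternating_SucE) (rule that; simp)
  show ?case
  proof (rule alternating_SucI[where g="\<lambda>l. f' l + g' l"])
    fix l assume l: "l > a"
    show "0 \<le> f l + g l" using Suc.prems[THEN alternating_nonneg, OF l] by simp
    show "((\<lambda>l. f l + g l) has_real_derivative - (f' l + g' l)) (at l)"
      using DERIV_add[OF f'(1)[OF l] g'(1)[OF l]] by simp
  qed (rule Suc.IH[OF f'(2) g'(2)])
qed simp

lemma alternating_mult: "alternating a n f \<Longrightarrow> alternating a n g \<Longrightarrow> alternating a n (\<lambda>l. f l * g l)"
proof (induction n arbitrary: f g)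
  case (Suc n)
  obtain f' where f': "\<And>l. l > a \<Longrightarrow> (f has_real_derivative - f' l) (at l)" "alternating a n f'"
    using Suc.prems(1) by (rule alternating_SucE) (rule that; simp)
  obtain g' where g': "\<And>l. l > a \<Longrightarrow> (g has_real_derivative - g' l) (at l)" "alternating a n g'"
    using Suc.prems(2) by (rule alternating_SucE) (rule that; simp)
  show ?case
  proof (rule alternating_SucI[where g="\<lambda>l. f' l * g l + f l * g' l"])
    fix l assume l: "l > a"
    show "0 \<le> f l * g l" using Suc.prems[THEN alternating_nonneg, OF l] by simp
    show "((\<lambda>l. f l * g l) has_real_derivative - (f' l * g l + f l * g' l)) (at l)"
      using DERIV_mult[OF f'(1)[OF l] g'(1)[OF l]] by (simp add: algebra_simps)
  next
    show "alternating a n (\<lambda>l. f' l * g l + f l * g' l)"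
      by (rule alternating_add[OF Suc.IH[OF f'(2) alternating_Suc[OF Suc.prems(2)]] Suc.IH[OF alternating_Suc[OF Suc.prems(1)] g'(2)]])
  qed
qed simp

text \<open>Minus the derivative of \<open>1 / p\<close> is \<open>p'\<close> times two copies of
  \<open>1 / p\<close>, and these need only be alternating to order \<open>n\<close> for
  \<open>1 / p\<close> to be so to order \<open>Suc n\<close>.\<close>

lemma alternating_inverse:
  assumes pos: "\<And>l. l > a \<Longrightarrow> 0 < p l"
    and der: "\<And>l. l > a \<Longrightarrow> (p has_real_derivative p' l) (at l)"
    and cm: "\<And>n. alternating a n p'"
  shows "alternating a n (\<lambda>l. inverse (p l))"
proof (induction n)
  case 0
  show ?case using pos by (simp add: less_imp_le)
next
  case (Suc n)
  show ?case
  proof (rule alternating_SucI[where g="\<lambda>l. p' l * (inverse (p l) * inverse (p l))"])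
    fix l assume l: "l > a"
    show "0 \<le> inverse (p l)" using pos[OF l] by simp
    show "((\<lambda>l. inverse (p l)) has_real_derivative - (p' l * (inverse (p l) * inverse (p l)))) (at l)"
      using DERIV_inverse'[OF der[OF l]] pos[OF l] by (simp add: mult_ac)
  qed (intro alternating_mult cm Suc.IH)
qed

lemma alternating_sequence:
  assumes nonneg: "\<And>j l. l > a \<Longrightarrow> 0 \<le> F j l"
    and der: "\<And>j l. l > a \<Longrightarrow> (F j has_real_derivative - F (Suc j) l) (at l)"
  shows "alternating a n (F j)"
proof (induction n arbitrary: j)
  case (Suc n)
  show ?case by (rule alternating_SucI[OF nonneg der Suc.IH])
qed (simp add: nonneg)

text \<open>The derivatives inside \<open>alternating\<close> are hidden behind existential
  quantifiers; uniqueness of derivatives identifies them with an explicit sequence.\<close>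

lemma alternating_derivatives_nonneg:
  assumes "alternating a n f" and "\<And>l. l > a \<Longrightarrow> f l = F 0 l"
    and "\<And>j l. l > a \<Longrightarrow> (F j has_real_derivative - F (Suc j) l) (at l)"
    and l: "l > a"
  shows "0 \<le> F n l"
  using assms(1-3)
proof (induction n arbitrary: f F)
  case 0
  thus ?case using l by (metis alternating_nonneg)
next
  case (Suc n)
  obtain g where g: "\<And>l. l > a \<Longrightarrow> (f has_real_derivative - g l) (at l)" "alternating a n g"
    using Suc.prems(1) by (rule alternating_SucE) (rule that; simp)
  have gF: "g l = F (Suc 0) l" if l: "l > a" for l
  proof -
    have "(F 0 has_real_derivative - g l) (at l)"
      by (rule has_field_derivative_transform_within_open[OF g(1)[OF l], of "{a<..}"])
        (use l Suc.prems(2) in auto)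
    from DERIV_unique[OF this Suc.prems(3)[OF l]] show ?thesis by simp
  qed
  show ?case
    by (rule Suc.IH[OF g(2), of "\<lambda>j. F (Suc j)"]) (rule gF Suc.prems(3); assumption)+
qed

lemma alternating_left_mono: "alternating a n f \<Longrightarrow> a \<le> b \<Longrightarrow> alternating b n f"
proof (induction n arbitrary: f)
  case (Suc n)
  obtain f' where f': "\<And>l. l > a \<Longrightarrow> (f has_real_derivative - f' l) (at l)" "alternating a n f'"
    using Suc.prems(1) by (rule alternating_SucE) (rule that; simp)
  show ?case
    by (rule alternating_SucI[OF _ _ Suc.IH[OF f'(2) Suc.prems(2)]])
      (use Suc.prems alternating_nonneg[OF Suc.prems(1)] f'(1) in simp_all)
qed simp

lemma alternating_cong:
  assumes "alternating a n f" and eq: "\<And>l. l > a \<Longrightarrow> g l = f l"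
  shows "alternating a n g"
proof (cases n)
  case 0
  thus ?thesis using assms by simp
next
  case (Suc m)
  obtain f' where f': "\<And>l. l > a \<Longrightarrow> (f has_real_derivative - f' l) (at l)" "alternating a m f'"
    using assms(1) unfolding Suc by (rule alternating_SucE) (rule that; simp)
  show ?thesis unfolding Suc
  proof (rule alternating_SucI[OF _ _ f'(2)])
    fix l assume l: "l > a"
    show "0 \<le> g l" using eq[OF l] alternating_nonneg[OF assms(1) l] by simp
    show "(g has_real_derivative - f' l) (at l)"
      by (rule has_field_derivative_transform_within_open[OF f'(1)[OF l], of "{a<..}"]) (use l eq in auto)
  qed
qed

lemma alternating_inverse_ident: "0 \<le> a \<Longrightarrow> alternating a n inverse"
  by (rule alternating_inverse[where p="\<lambda>l. l" and p'="\<lambda>_. 1"]) (auto intro: alternating_const)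

subsection \<open>Laplace transforms\<close>

text \<open>Up to the sign \<open>(-1)^n\<close>, the n-th derivative of the Laplace transform of
  \<open>V\<close>.\<close>

definition laplace_moment :: "(real \<Rightarrow> real) \<Rightarrow> nat \<Rightarrow> real \<Rightarrow> real" where
  "laplace_moment V n l = (LINT y|lborel. indicator {0..} y * (y ^ n * exp (- l * y) * V y))"

lemma laplace_moment_nonneg_derivative:
  assumes V0: "\<And>y. 0 \<le> V y"
    and int: "\<And>l. l > a \<Longrightarrow> integrable lborel (\<lambda>y. indicator {0..} y * (exp (- l * y) * V y))"
    and l: "l > a"
  shows "integrable lborel (\<lambda>y. indicator {0..} y * (y ^ n * exp (- l * y) * V y))"
    and "(laplace_moment V n has_real_derivative - laplace_moment V (Suc n) l) (at l)"
proof -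
  let ?f = "\<lambda>n l y. indicator {0..} y * (y ^ n * exp (- l * y) * V y) :: real"
  have der: "((\<lambda>l. ?f n l y) has_real_derivative - ?f (Suc n) l y) (at l)" for n l y
    by (auto intro!: derivative_eq_intros simp: algebra_simps)
  have nonneg: "0 \<le> ?f n l y" for n l y using V0 by (auto simp: indicator_def)
  have anti: "?f n l' y \<le> ?f n l y" if "l \<le> l'" for n l l' y
    using V0 that by (auto simp: indicator_def intro!: mult_right_mono mult_left_mono)
  have int_n: "integrable lborel (?f n l)" if l: "l > a" for n l
    using l
  proof (induction n arbitrary: l)
    case 0
    thus ?case using int by simp
  next
    case (Suc n)
    show ?case
      by (rule LINT_parametric_derivative(1)[where a=a and g="?f n", OF Suc.IH der nonneg anti Suc.prems])
  qed
  show "integrable lborel (?f n l)" by (rule int_n[OF l])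
  show "(laplace_moment V n has_real_derivative - laplace_moment V (Suc n) l) (at l)"
    unfolding laplace_moment_def[abs_def]
    by (rule LINT_parametric_derivative(2)[where a=a and g="?f n", OF int_n der nonneg anti l])
qed

text \<open>Domination by monotonicity needs a sign, and none is known yet for the scale function
  when this is applied to it; hence the split into positive and negative part.\<close>

lemma laplace_moment_derivative:
  assumes [measurable]: "V \<in> borel_measurable borel"
    and int: "\<And>l. l > a \<Longrightarrow> integrable lborel (\<lambda>y. indicator {0..} y * (exp (- l * y) * V y))"
    and l: "l > a"
  shows "integrable lborel (\<lambda>y. indicator {0..} y * (y ^ n * exp (- l * y) * V y))" (is ?I)
    and "(laplace_moment V n has_real_derivative - laplace_moment V (Suc n) l) (at l)" (is ?D)
proof -
  define P where "P y = max 0 (V y)" for y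
  define N where "N y = max 0 (- V y)" for y
  have V: "V y = P y - N y" for y by (auto simp: P_def N_def)
  have [measurable]: "P \<in> borel_measurable borel" "N \<in> borel_measurable borel"
    unfolding P_def N_def by measurable
  have Pint: "integrable lborel (\<lambda>y. indicator {0..} y * (exp (- l * y) * P y))" if "l > a" for l
    by (rule Bochner_Integration.integrable_bound[OF int[OF that]])
      (auto simp: P_def indicator_def abs_mult)
  have Nint: "integrable lborel (\<lambda>y. indicator {0..} y * (exp (- l * y) * N y))" if "l > a" for l
    by (rule Bochner_Integration.integrable_bound[OF int[OF that]])
      (auto simp: N_def indicator_def abs_mult)
  note PD = laplace_moment_nonneg_derivative[of P a, OF _ Pint]
  note ND = laplace_moment_nonneg_derivative[of N a, OF _ Nint]
  have P0: "0 \<le> P y" and N0: "0 \<le> N y" for y by (auto simp: P_def N_def)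
  have eq: "indicator {0..} y * (y ^ n * exp (- l * y) * V y) =
     indicator {0..} y * (y ^ n * exp (- l * y) * P y) - indicator {0..} y * (y ^ n * exp (- l * y) * N y)" for n l y
    unfolding V by (simp add: algebra_simps)
  have LM: "laplace_moment V n l = laplace_moment P n l - laplace_moment N n l" if "l > a" for n l
    unfolding laplace_moment_def eq using PD(1)[OF P0 _ that] ND(1)[OF N0 _ that]
    by (intro Bochner_Integration.integral_diff) auto
  show ?I unfolding eq using PD(1)[OF P0 _ l] ND(1)[OF N0 _ l]
    by (intro Bochner_Integration.integrable_diff) auto
  have "((\<lambda>l. laplace_moment P n l - laplace_moment N n l) has_real_derivative
      - laplace_moment P (Suc n) l - - laplace_moment N (Suc n) l) (at l)"
    using PD(2)[OF P0 _ l] ND(2)[OF N0 _ l] by (intro DERIV_diff) auto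
  hence "((\<lambda>l. laplace_moment P n l - laplace_moment N n l) has_real_derivative
      - laplace_moment V (Suc n) l) (at l)" unfolding LM[OF l] by simp
  thus ?D
    by (rule has_field_derivative_transform_within_open[of _ _ _ "{a<..}"]) (use l LM in auto)
qed

subsection \<open>Post--Widder inversion\<close>

text \<open>One term of the series of \<open>exp n\<close>. It replaces Stirling's formula: the
  accuracy lost is absorbed by a geometric factor later.\<close>

lemma power_exp_le_fact: "real n ^ n * exp (- real n) \<le> fact n"
proof -
  have "(\<Sum>k\<in>{n}. real n ^ k /\<^sub>R fact k) \<le> (\<Sum>k. real n ^ k /\<^sub>R fact k)"
    by (rule sum_le_suminf) (use exp_converges[of "real n"] in \<open>auto simp: sums_iff\<close>)
  also have "\<dots> = exp (real n)" using exp_converges[of "real n"] by (simp add: sums_iff)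
  finally have "real n ^ n / fact n \<le> exp (real n)" by (simp add: divide_inverse mult.commute)
  hence "real n ^ n \<le> exp (real n) * fact n" by (simp add: pos_divide_le_eq)
  thus ?thesis by (simp add: exp_minus field_simps)
qed

text \<open>The function \<open>r * exp (1 - r)\<close> has its maximum 1 at \<open>r = 1\<close>.
  The bound \<open>exp v \<ge> 1 + v\<close> at \<open>v = (r - 1) / 2\<close>, squared, reduces it
  to \<open>4 * r / (r + 1)^2\<close>, which is invariant under \<open>r \<mapsto> 1 / r\<close>;
  the right-hand side is its value at \<open>1 + s\<close>.\<close>

lemma mult_exp_bound_away:
  fixes r s :: real
  assumes r: "0 \<le> r" and s: "0 < s" "s \<le> \<bar>r - 1\<bar>"
  shows "r * exp (1 - r) \<le> 4 * (1 + s) / (2 + s)\<^sup>2"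
proof -
  have "(1 + (r - 1) / 2)\<^sup>2 \<le> (exp ((r - 1) / 2))\<^sup>2"
    using r exp_ge_add_one_self[of "(r - 1) / 2"] by (intro power_mono) (auto simp: field_simps)
  also have "\<dots> = exp (r - 1)" by (simp add: power2_eq_square mult_exp_exp)
  finally have e: "(r + 1)\<^sup>2 / 4 \<le> exp (r - 1)" by (simp add: power2_eq_square field_simps)
  have "r * exp (1 - r) = r / exp (r - 1)" by (simp add: exp_diff)
  also have "\<dots> \<le> r / ((r + 1)\<^sup>2 / 4)" using e r by (intro divide_left_mono) auto
  also have "\<dots> = 4 * r / (r + 1)\<^sup>2" by simp
  also have "\<dots> \<le> 4 * (1 + s) / (2 + s)\<^sup>2"
  proof -
    \<comment> \<open>After clearing denominators this is the whole inequality. Its roots are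
      \<open>1 + s\<close> and \<open>1 / (1 + s)\<close>, and
      \<open>1 - s \<le> 1 / (1 + s)\<close> covers the left side.\<close>
    have "0 \<le> ((1 + s) * r - 1) * (r - (1 + s))"
    proof (cases "r \<ge> 1")
      case True
      hence "r \<ge> 1 + s" using s by simp
      moreover have "1 \<le> (1 + s) * r" using True s mult_mono[of 1 "1 + s" 1 r] by simp
      ultimately show ?thesis by simp
    next
      case False
      hence rs: "r \<le> 1 - s" using s by simp
      have "(1 + s) * r \<le> (1 + s) * (1 - s)" using rs s by (intro mult_left_mono) auto
      also have "\<dots> \<le> 1" by (simp add: algebra_simps)
      finally show ?thesis using rs s by (intro mult_nonpos_nonpos) auto
    qed
    hence "4 * r * (2 + s)\<^sup>2 \<le> 4 * (1 + s) * (r + 1)\<^sup>2" by (simp add: power2_eq_square algebra_simps)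
    moreover have "0 < (r + 1)\<^sup>2" "0 < (2 + s)\<^sup>2" using r s by auto
    ultimately show ?thesis by (simp add: pos_divide_le_eq pos_le_divide_eq)
  qed
  finally show ?thesis .
qed

lemma erlang_density_integral:
  assumes "0 < l"
  shows "integrable lborel (erlang_density k l)" "(LINT y|lborel. erlang_density k l y) = 1"
proof -
  have nn: "(\<integral>\<^sup>+ y. ennreal (erlang_density k l y) \<partial>lborel) = 1"
    using nn_integral_erlang_ith_moment[OF assms, of k 0] by simp
  show "integrable lborel (erlang_density k l)"
    using nn assms by (intro integrableI_nonneg) auto
  show "(LINT y|lborel. erlang_density k l y) = 1"
    using nn assms by (subst integral_eq_nn_integral) auto
qed

text \<open>The n-th term is the mean of \<open>V\<close> under the Erlang density with mode
  \<open>x\<close>. This density is at most \<open>real n / x * u y ^ n\<close>, where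
  \<open>u\<close> has maximum 1 at \<open>x\<close> and stays below some \<eta> < 1 away from
  \<open>x\<close>, so it concentrates at \<open>x\<close>.\<close>

lemma post_widder:
  fixes V :: "real \<Rightarrow> real"
  assumes [measurable]: "V \<in> borel_measurable borel"
    and int: "\<And>l. l > a \<Longrightarrow> integrable lborel (\<lambda>y. indicator {0..} y * (exp (- l * y) * V y))"
    and x: "0 < x" and cont: "isCont V x"
  shows "(\<lambda>n. (real n / x) ^ Suc n / fact n * laplace_moment V n (real n / x)) \<longlonglongrightarrow> V x"
proof -
  define b where "b = max a 0"
  define U where "U y = V y - V x" for y
  define er where "er n = erlang_density n (real n / x)" for n
  define u where "u y = y / x * exp (1 - y / x)" for y
  have [measurable]: "U \<in> borel_measurable borel" unfolding U_def by measurable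
  have er_eq: "erlang_density n l y = l ^ Suc n / fact n * (indicator {0..} y * (y ^ n * exp (- l * y)))" for n l y
    by (auto simp: erlang_density_def indicator_def)
  have int_exp: "integrable lborel (\<lambda>y. indicator {0..} y * exp (- l * y))" if "l > b" for l
  proof -
    have "integrable lborel (\<lambda>y. erlang_density 0 l y / l)"
      using that by (intro integrable_divide erlang_density_integral) (auto simp: b_def)
    also have "(\<lambda>y. erlang_density 0 l y / l) = (\<lambda>y. indicator {0..} y * exp (- l * y))"
      using that by (auto simp: er_eq b_def)
    finally show ?thesis .
  qed
  have int_U: "integrable lborel (\<lambda>y. indicator {0..} y * (exp (- l * y) * U y))" if "l > b" for l
  proof -
    have "integrable lborel (\<lambda>y. indicator {0..} y * (exp (- l * y) * V y) - V x * (indicator {0..} y * exp (- l * y)))"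
      using int[of l] int_exp[OF that] that
      by (intro Bochner_Integration.integrable_diff integrable_mult_right) (auto simp: b_def)
    thus ?thesis by (simp add: U_def algebra_simps)
  qed
  \<comment> \<open>The power \<open>u y ^ m\<close> is set aside to make \<open>U\<close>
    integrable far out; the remaining \<open>n - m\<close> powers give the geometric decay.\<close>
  obtain m where m: "m > 0" "real m / x > b"
  proof -
    obtain m where "real m > x * b" using reals_Archimedean2 by blast
    moreover have "x * b \<ge> 0" using x by (simp add: b_def)
    ultimately have "m > 0" "real m / x > b"
      using x by (auto simp: pos_less_divide_eq mult.commute intro: gr0I)
    thus thesis by (rule that)
  qed
  have large: "real n / x > b" "n > 0" if "n \<ge> m" for n
  proof -
    have "real m / x \<le> real n / x" using that x by (intro divide_right_mono) auto
    thus "real n / x > b" using m by simp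
  qed (use m that in auto)
  have diff: "(real n / x) ^ Suc n / fact n * laplace_moment V n (real n / x) - V x = (LINT y|lborel. er n y * U y)"
    and er_U: "integrable lborel (\<lambda>y. er n y * U y)"
    if n: "n \<ge> m" for n
  proof -
    note l = large[OF n]
    have l0: "real n / x > 0" using l x by simp
    have IV: "integrable lborel (\<lambda>y. er n y * V y)" and LV: "(LINT y|lborel. er n y * V y) = (real n / x) ^ Suc n / fact n * laplace_moment V n (real n / x)"
    proof -
      have eq: "(\<lambda>y. er n y * V y) = (\<lambda>y. (real n / x) ^ Suc n / fact n * (indicator {0..} y * (y ^ n * exp (- (real n / x) * y) * V y)))"
        by (simp add: er_def er_eq mult_ac)
      have "integrable lborel (\<lambda>y. indicator {0..} y * (y ^ n * exp (- (real n / x) * y) * V y))"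
        by (rule laplace_moment_derivative(1)[where a=a]) (use int l in \<open>auto simp: b_def\<close>)
      thus "integrable lborel (\<lambda>y. er n y * V y)" unfolding eq by (rule integrable_mult_right)
      show "(LINT y|lborel. er n y * V y) = (real n / x) ^ Suc n / fact n * laplace_moment V n (real n / x)"
        unfolding eq laplace_moment_def by (rule integral_mult_right_zero)
    qed
    have IE: "integrable lborel (er n)" and LE: "(LINT y|lborel. er n y) = 1"
      unfolding er_def using erlang_density_integral[OF l0] by auto
    have eqU: "(\<lambda>y. er n y * U y) = (\<lambda>y. er n y * V y - V x * er n y)"
      by (simp add: U_def algebra_simps)
    show "integrable lborel (\<lambda>y. er n y * U y)" unfolding eqU
      by (intro Bochner_Integration.integrable_diff IV integrable_mult_right IE)
    have "(LINT y|lborel. er n y * U y) = (LINT y|lborel. er n y * V y) - (LINT y|lborel. V x * er n y)"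
      unfolding eqU by (intro Bochner_Integration.integral_diff IV integrable_mult_right IE)
    thus "(real n / x) ^ Suc n / fact n * laplace_moment V n (real n / x) - V x = (LINT y|lborel. er n y * U y)"
      by (simp add: LV LE)
  qed
  define R where "R y = \<bar>indicator {0..} y * (u y ^ m * U y)\<bar>" for y
  have R_int: "integrable lborel R"
  proof -
    have "integrable lborel (\<lambda>y. (exp 1 / x) ^ m * (indicator {0..} y * (y ^ m * exp (- (real m / x) * y) * U y)))"
      by (intro integrable_mult_right laplace_moment_derivative(1)[where a=b] int_U m) auto
    also have "(\<lambda>y. (exp 1 / x) ^ m * (indicator {0..} y * (y ^ m * exp (- (real m / x) * y) * U y)))
       = (\<lambda>y. indicator {0..} y * (u y ^ m * U y))"
    proof
      fix y
      have "exp (1 - y / x) ^ m = exp 1 ^ m * exp (- (real m / x) * y)"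
        by (simp add: exp_of_nat_mult[symmetric] mult_exp_exp algebra_simps)
      thus "(exp 1 / x) ^ m * (indicator {0..} y * (y ^ m * exp (- (real m / x) * y) * U y))
         = indicator {0..} y * (u y ^ m * U y)"
        by (simp add: u_def power_mult_distrib power_divide)
    qed
    finally show ?thesis unfolding R_def by (rule integrable_abs)
  qed
  have u0: "0 \<le> u y" if "0 \<le> y" for y using that x by (simp add: u_def)
  have er_u: "er n y \<le> real n / x * u y ^ n" if y: "0 \<le> y" for n y
  proof -
    have "exp (1 - y / x) ^ n = exp (real n) * exp (- (real n / x) * y)"
      by (simp add: exp_of_nat_mult[symmetric] mult_exp_exp algebra_simps)
    hence "er n y = real n / x * (real n ^ n * exp (- real n) / fact n) * u y ^ n"
      using y x by (simp add: er_def er_eq u_def power_mult_distrib power_divide exp_minus field_simps)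
    also have "\<dots> \<le> real n / x * 1 * u y ^ n"
      using x u0[OF y] power_exp_le_fact[of n]
      by (intro mult_right_mono mult_left_mono) (auto simp: pos_divide_le_eq)
    finally show ?thesis by simp
  qed
  show ?thesis
  proof (rule LIMSEQ_I)
    fix e :: real assume e: "0 < e"
    obtain \<delta> where \<delta>: "\<delta> > 0" "\<And>y. \<bar>y - x\<bar> < \<delta> \<Longrightarrow> \<bar>U y\<bar> < e / 2"
      using cont e unfolding isCont_def LIM_def U_def dist_real_def
      by (metis abs_zero diff_self half_gt_zero)
    define s where "s = \<delta> / x"
    define \<eta> where "\<eta> = 4 * (1 + s) / (2 + s)\<^sup>2"
    have s: "s > 0" using \<delta> x by (simp add: s_def)
    have \<eta>: "0 < \<eta>" "\<eta> < 1"
    proof -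
      have "4 * (1 + s) < (2 + s)\<^sup>2" using s by (simp add: power2_eq_square algebra_simps)
      thus "0 < \<eta>" "\<eta> < 1" using s by (auto simp: \<eta>_def)
    qed
    have u_le: "u y \<le> \<eta>" if "0 \<le> y" "\<bar>y - x\<bar> \<ge> \<delta>" for y
    proof -
      have "\<bar>y / x - 1\<bar> = \<bar>y - x\<bar> / x" using x by (simp add: abs_if field_simps)
      hence "s \<le> \<bar>y / x - 1\<bar>" using that x by (simp add: s_def divide_right_mono)
      thus ?thesis unfolding u_def \<eta>_def using that x s by (intro mult_exp_bound_away) auto
    qed
    \<comment> \<open>Near \<open>x\<close> continuity makes \<open>U\<close> small and the density
      has mass 1; elsewhere the integrable \<open>R\<close> is multiplied by a factor tending to
      0.\<close>
    have bound: "\<bar>er n y * U y\<bar> \<le> e / 2 * er n y + real n / x * \<eta> ^ (n - m) * R y" if n: "n \<ge> m" for n y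
    proof (cases "y < 0")
      case True
      thus ?thesis by (simp add: er_def erlang_density_def R_def)
    next
      case False
      hence y: "0 \<le> y" by simp
      have er0: "0 \<le> er n y" using x by (simp add: er_def)
      have R0: "0 \<le> R y" by (simp add: R_def)
      show ?thesis
      proof (cases "\<bar>y - x\<bar> < \<delta>")
        case True
        have "\<bar>er n y * U y\<bar> \<le> e / 2 * er n y"
          using mult_right_mono[OF less_imp_le[OF \<delta>(2)[OF True]] er0] er0 by (simp add: abs_mult mult.commute)
        moreover have "0 \<le> real n / x * \<eta> ^ (n - m) * R y" using x \<eta> R0 by simp
        ultimately show ?thesis by linarith
      next
        case False
        have "er n y \<le> real n / x * (u y ^ (n - m) * u y ^ m)"
          using er_u[OF y, of n] n by (simp add: power_add[symmetric])
        also have "\<dots> \<le> real n / x * (\<eta> ^ (n - m) * u y ^ m)"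
          using u_le[OF y] False u0[OF y] x by (intro mult_left_mono mult_right_mono power_mono) auto
        finally have "er n y * \<bar>U y\<bar> \<le> real n / x * (\<eta> ^ (n - m) * u y ^ m) * \<bar>U y\<bar>"
          by (rule mult_right_mono) simp
        hence "\<bar>er n y * U y\<bar> \<le> real n / x * (\<eta> ^ (n - m) * u y ^ m) * \<bar>U y\<bar>"
          using er0 by (simp only: abs_mult abs_of_nonneg)
        also have "\<dots> = real n / x * \<eta> ^ (n - m) * R y"
          using y u0[OF y] by (simp add: R_def abs_mult)
        finally have "\<bar>er n y * U y\<bar> \<le> real n / x * \<eta> ^ (n - m) * R y" .
        moreover have "0 \<le> e / 2 * er n y" using e er0 by simp
        ultimately show ?thesis by linarith
      qed
    qed
    define C where "C = (LINT y|lborel. R y)"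
    have est: "\<bar>(real n / x) ^ Suc n / fact n * laplace_moment V n (real n / x) - V x\<bar>
       \<le> e / 2 + real n * \<eta> ^ n * (C / (x * \<eta> ^ m))" if n: "n \<ge> m" for n
    proof -
      have l0: "real n / x > 0" using large[OF n] x by simp
      have IE: "integrable lborel (er n)" and LE: "(LINT y|lborel. er n y) = 1"
        unfolding er_def using erlang_density_integral[OF l0] by auto
      have "\<bar>LINT y|lborel. er n y * U y\<bar> \<le> (LINT y|lborel. \<bar>er n y * U y\<bar>)"
        by (rule integral_abs_bound)
      also have "\<dots> \<le> (LINT y|lborel. e / 2 * er n y + real n / x * \<eta> ^ (n - m) * R y)"
        by (intro integral_mono integrable_abs er_U n Bochner_Integration.integrable_add integrable_mult_right IE R_int bound)
      also have "\<dots> = (LINT y|lborel. e / 2 * er n y) + (LINT y|lborel. real n / x * \<eta> ^ (n - m) * R y)"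
        by (intro Bochner_Integration.integral_add integrable_mult_right IE R_int)
      also have "\<dots> = e / 2 + real n / x * \<eta> ^ (n - m) * C" by (simp add: LE C_def)
      also have "\<eta> ^ (n - m) = \<eta> ^ n / \<eta> ^ m" using \<eta> n by (simp add: power_diff)
      finally show ?thesis unfolding diff[OF n] by (simp add: field_simps)
    qed
    have "(\<lambda>n. real n * \<eta> ^ n * (C / (x * \<eta> ^ m))) \<longlonglongrightarrow> 0 * (C / (x * \<eta> ^ m))"
      using powser_times_n_limit_0[of \<eta>] \<eta> by (intro tendsto_mult_right) auto
    hence "eventually (\<lambda>n. real n * \<eta> ^ n * (C / (x * \<eta> ^ m)) < e / 2) sequentially"
      using e by (intro order_tendstoD(2)[where y=0]) auto
    then obtain N where N: "\<And>n. n \<ge> N \<Longrightarrow> real n * \<eta> ^ n * (C / (x * \<eta> ^ m)) < e / 2"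
      by (auto simp: eventually_sequentially)
    show "\<exists>N. \<forall>n\<ge>N. norm ((real n / x) ^ Suc n / fact n * laplace_moment V n (real n / x) - V x) < e"
    proof (intro exI[of _ "max N m"] allI impI)
      fix n assume "max N m \<le> n"
      thus "norm ((real n / x) ^ Suc n / fact n * laplace_moment V n (real n / x) - V x) < e"
        using est[of n] N[of n] unfolding real_norm_def by linarith
    qed
  qed
qed

text \<open>The functions \<open>l F\<^sub>n - n F\<^sub>n\<^sub>-\<^sub>1\<close>, with \<open>F\<^sub>n\<close> the moments, are up to sign the
  derivatives of \<open>l F\<^sub>0\<close>, and they are also the derivatives of the Post--Widder
  approximations with respect to the point of evaluation.\<close>

lemma mono_of_laplace_alternating:
  fixes V :: "real \<Rightarrow> real"
  assumes [measurable]: "V \<in> borel_measurable borel"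
    and int: "\<And>l. l > a \<Longrightarrow> integrable lborel (\<lambda>y. indicator {0..} y * (exp (- l * y) * V y))"
    and a: "0 \<le> a"
    and cm: "\<And>n. alternating a n (\<lambda>l. l * laplace_moment V 0 l)"
    and x: "0 < x" "x \<le> y" and cont: "isCont V x" "isCont V y"
  shows "V x \<le> V y"
proof -
  let ?F = "laplace_moment V"
  have F': "(?F n has_real_derivative - ?F (Suc n) l) (at l)" if "l > a" for n l
    by (rule laplace_moment_derivative(2)[OF assms(1) int that])
  \<comment> \<open>At \<open>n = 0\<close> the truncated difference \<open>n - 1\<close> is 0,
    which is harmless because the factor \<open>real n\<close> vanishes.\<close>
  define G where "G n l = l * ?F n l - real n * ?F (n - 1) l" for n l
  have G': "(G n has_real_derivative - G (Suc n) l) (at l)" if l: "l > a" for n l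
  proof (cases n)
    case 0
    show ?thesis unfolding G_def[abs_def] 0
      using DERIV_mult[OF DERIV_ident F'[OF l, of 0]] by (simp add: algebra_simps)
  next
    case (Suc k)
    show ?thesis unfolding G_def[abs_def] Suc
      using DERIV_diff[OF DERIV_mult[OF DERIV_ident F'[OF l, of "Suc k"]] DERIV_cmult[OF F'[OF l, of k], of "real (Suc k)"]]
      by (simp add: algebra_simps)
  qed
  have G0: "0 \<le> G n l" if "l > a" for n l
    by (rule alternating_derivatives_nonneg[where F=G, OF cm _ G' that]) (simp_all add: G_def)
  define Q where "Q n l = l ^ Suc n / fact n * ?F n l" for n l
  \<comment> \<open>The product rule leaves the factor
    \<open>real (Suc n) * ?F n l - l * ?F (Suc n) l\<close>, which is \<open>- G (Suc n) l\<close>;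
    the signs of \<open>G\<close> thus become monotonicity in the rate.\<close>
  have Q': "(Q n has_real_derivative - (l ^ n / fact n * G (Suc n) l)) (at l)" if l: "l > a" for n l
    unfolding Q_def[abs_def] G_def
    by (rule DERIV_cong[OF DERIV_mult[OF DERIV_cdivide[OF DERIV_pow] F'[OF l]]]) (simp add: field_simps)
  have Q_anti: "Q n r \<le> Q n p" if "a < p" "p \<le> r" for n p r
  proof (rule DERIV_nonpos_imp_nonincreasing[OF that(2)])
    fix l assume "p \<le> l"
    hence l: "l > a" using that by simp
    have "0 \<le> l ^ n / fact n * G (Suc n) l" using G0[OF l] a l by simp
    thus "\<exists>D. (Q n has_real_derivative D) (at l) \<and> D \<le> 0" using Q'[OF l, of n] by (intro exI conjI) auto
  qed
  have lim: "(\<lambda>n. Q n (real n / x)) \<longlonglongrightarrow> V x" "(\<lambda>n. Q n (real n / y)) \<longlonglongrightarrow> V y"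
    unfolding Q_def using x cont by (intro post_widder[OF assms(1) int]; simp)+
  obtain N where N: "real N > a * y" using reals_Archimedean2 by blast
  \<comment> \<open>A larger evaluation point means a smaller rate, so antitone \<open>Q n\<close>
    orders the values the right way. Both rates exceed \<open>a\<close> once
    \<open>n > a * y\<close>.\<close>
  have "Q n (real n / x) \<le> Q n (real n / y)" if "n \<ge> N" for n
  proof (rule Q_anti)
    have "a * y < real n" using N that by (meson less_le_trans of_nat_mono)
    thus "a < real n / y" using x by (simp add: pos_less_divide_eq)
    show "real n / y \<le> real n / x" using x by (intro divide_left_mono) auto
  qed
  thus ?thesis using LIMSEQ_le[OF lim] by blast
qed

subsection \<open>The Laplace exponent\<close>

text \<open>For \<open>j = 0\<close> this is \<open>(1 - exp (- l * z)) / l\<close>; written as an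
  integral of exponentials it can be differentiated in \<open>l\<close> any number of times with
  visible signs.\<close>

definition truncated_moment :: "nat \<Rightarrow> real \<Rightarrow> real \<Rightarrow> real" where
  "truncated_moment j l z = (LINT x|lborel. indicator {0..z} x * (x ^ j * exp (- l * x)))"

lemma truncated_moment_derivative: "((\<lambda>l. truncated_moment j l z) has_real_derivative - truncated_moment (Suc j) l z) (at l)"
  unfolding truncated_moment_def
\<comment> \<open>The integrand lives on a compact interval, so any number below \<open>l\<close>
  can serve as left end of the parameter range.\<close>
proof (rule LINT_parametric_derivative(2)[where a="l - 1"])
  fix l :: real
  have "integrable lborel (\<lambda>x. indicator {0..z} x *\<^sub>R (x ^ j * exp (- l * x)))"
    by (intro borel_integrable_compact continuous_intros) auto
  thus "integrable lborel (\<lambda>x. indicator {0..z} x * (x ^ j * exp (- l * x)))" by simp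
next
  fix l x :: real
  show "((\<lambda>l. indicator {0..z} x * (x ^ j * exp (- l * x))) has_real_derivative
     - (indicator {0..z} x * (x ^ Suc j * exp (- l * x)))) (at l)"
    by (auto intro!: derivative_eq_intros simp: algebra_simps)
qed (auto simp: indicator_def intro!: mult_left_mono mult_right_mono)

lemma truncated_moment_nonneg: "0 \<le> truncated_moment j l z"
  unfolding truncated_moment_def by (intro integral_nonneg_AE) (auto simp: indicator_def)

lemma truncated_moment_antimono: "l \<le> l' \<Longrightarrow> truncated_moment j l' z \<le> truncated_moment j l z"
  by (rule DERIV_nonpos_imp_nonincreasing)
    (use truncated_moment_derivative truncated_moment_nonneg in \<open>auto intro!: exI[of _ "- truncated_moment (Suc j) _ z"]\<close>)

lemma truncated_moment_neg: "z < 0 \<Longrightarrow> truncated_moment j l z = 0"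
  by (simp add: truncated_moment_def)

lemma truncated_moment_0:
  assumes "l \<noteq> 0" "0 \<le> z"
  shows "truncated_moment 0 l z = (1 - exp (- l * z)) / l"
proof -
  have "(LINT x|lborel. indicator {0..z} x *\<^sub>R exp (- l * x)) = - exp (- l * z) / l - (- exp (- l * 0) / l)"
  proof (rule integral_FTC_atLeastAtMost[OF assms(2)])
    fix x
    have "((\<lambda>x. - exp (- l * x) / l) has_real_derivative exp (- l * x)) (at x within {0..z})"
      using assms(1) by (auto intro!: derivative_eq_intros)
    thus "((\<lambda>x. - exp (- l * x) / l) has_vector_derivative exp (- l * x)) (at x within {0..z})"
      by (simp only: has_real_derivative_iff_has_vector_derivative)
  qed (intro continuous_intros)
  thus ?thesis by (simp add: truncated_moment_def diff_divide_distrib)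
qed

section \<open>The Levy measure and the compensated jump integral\<close>

locale levy_measure =
  fixes \<sigma> :: real and \<nu> :: "real measure"
  assumes triplet: "levy_triplet \<sigma> \<nu>"
begin

lemma sets_eq [measurable_cong]: "sets \<nu> = sets borel"
  and min_integrable: "integrable \<nu> (\<lambda>z. min 1 (z\<^sup>2))"
  and AE_pos: "AE z in \<nu>. 0 < z"
proof -
  show *: "sets \<nu> = sets borel" and "integrable \<nu> (\<lambda>z. min 1 (z\<^sup>2))"
    using triplet by (simp_all add: levy_triplet_def)
  have "emeasure \<nu> {..0} = 0" using triplet by (simp add: levy_triplet_def)
  hence "{..0} \<in> null_sets \<nu>" by (rule null_setsI) (simp add: *)
  thus "AE z in \<nu>. 0 < z" by (rule AE_I') (auto simp: not_less)
qed

text \<open>For \<open>z > 0\<close>, the integrand of the Laplace exponent divided by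
  \<open>- l\<close>.\<close>

definition compensated :: "real \<Rightarrow> real \<Rightarrow> real" where
  "compensated l z = truncated_moment 0 l z - z * indicator {0<..<1} z"

text \<open>The two constants belong to two ranges: on (0, 1) the first-order terms cancel and leave
  \<open>l * z^2\<close>, while from 1 on the function is at most \<open>1 / l\<close>.\<close>

lemma compensated_bound:
  assumes l: "0 < l"
  shows "\<bar>compensated l z\<bar> \<le> (l + 1 / l) * min 1 (z\<^sup>2)"
proof -
  consider "z \<le> 0" | "0 < z" "z < 1" | "1 \<le> z" by linarith
  thus ?thesis
  proof cases
    case 1
    thus ?thesis using l by (cases "z = 0") (auto simp: compensated_def truncated_moment_neg truncated_moment_0)
  next
    case 2
    define u where "u = l * z"
    have u: "u > 0" using l 2 by (simp add: u_def)
    \<comment> \<open>Elementary via \<open>(1 - u + u^2) * (1 + u) = 1 + u^3\<close> and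
      \<open>1 + u \<le> exp u\<close>.\<close>
    have "exp (- u) \<le> 1 - u + u\<^sup>2"
    proof -
      have "(1 - u + u\<^sup>2) * (1 + u) = 1 + u ^ 3" by (simp add: power2_eq_square power3_eq_cube algebra_simps)
      hence "1 \<le> (1 - u + u\<^sup>2) * (1 + u)" using u by simp
      also have "\<dots> \<le> (1 - u + u\<^sup>2) * exp u"
      proof (rule mult_left_mono)
        have "1 - u + u\<^sup>2 = (u - 1 / 2)\<^sup>2 + 3 / 4" by (simp add: power2_eq_square field_simps)
        thus "0 \<le> 1 - u + u\<^sup>2" by simp
      qed (use exp_ge_add_one_self[of u] in simp)
      finally show ?thesis by (simp add: exp_minus inverse_eq_divide pos_divide_le_eq)
    qed
    moreover have "1 - u \<le> exp (- u)" using exp_ge_add_one_self[of "- u"] by simp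
    ultimately have "\<bar>(1 - exp (- u) - u) / l\<bar> \<le> u\<^sup>2 / l"
      using l unfolding abs_divide by (simp add: divide_right_mono)
    moreover have "compensated l z = (1 - exp (- u) - u) / l"
      using 2 l by (simp add: compensated_def truncated_moment_0 u_def field_simps)
    moreover have "u\<^sup>2 / l = l * z\<^sup>2" using l by (simp add: u_def power2_eq_square)
    ultimately have "\<bar>compensated l z\<bar> \<le> l * z\<^sup>2" by simp
    also have "\<dots> \<le> (l + 1 / l) * z\<^sup>2" using l by (intro mult_right_mono) auto
    also have "z\<^sup>2 = min 1 (z\<^sup>2)" using 2 by (simp add: power_le_one)
    finally show ?thesis .
  next
    case 3
    have "\<bar>compensated l z\<bar> = (1 - exp (- l * z)) / l" using 3 l by (simp add: compensated_def truncated_moment_0)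
    also have "\<dots> \<le> 1 / l" using l by (intro divide_right_mono) auto
    also have "\<dots> \<le> l + 1 / l" using l by simp
    also have "min 1 (z\<^sup>2) = 1" using 3 by (simp add: min_def)
    hence "l + 1 / l = (l + 1 / l) * min 1 (z\<^sup>2)" by simp
    finally show ?thesis .
  qed
qed

lemma compensated_integrable:
  assumes l: "0 < l"
  shows "integrable \<nu> (compensated l)"
proof (rule Bochner_Integration.integrable_bound)
  show "integrable \<nu> (\<lambda>z. (l + 1 / l) * min 1 (z\<^sup>2))" by (intro integrable_mult_right min_integrable)
  have "compensated l = (\<lambda>z. (if z < 0 then 0 else (1 - exp (- l * z)) / l) - z * indicator {0<..<1} z)"
    using l by (auto simp: compensated_def truncated_moment_neg truncated_moment_0)
  thus "compensated l \<in> borel_measurable \<nu>" by simp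
  show "AE z in \<nu>. norm (compensated l z) \<le> norm ((l + 1 / l) * min 1 (z\<^sup>2))"
    using compensated_bound[OF l] l by (intro AE_I2) (auto intro: order_trans)
qed

lemma compensated_derivative: "((\<lambda>l. compensated l z) has_real_derivative - truncated_moment (Suc 0) l z) (at l)"
  unfolding compensated_def using DERIV_diff[OF truncated_moment_derivative[of 0 z l] DERIV_const] by simp

text \<open>The index is shifted by one because \<open>truncated_moment 0\<close> need not be
  integrable when small jumps are not summable, whereas its derivatives in \<open>l\<close> are. Up
  to sign these integrals are the successive derivatives of
  \<open>compensated_integral\<close>.\<close>

definition tail_moment :: "nat \<Rightarrow> real \<Rightarrow> real" where
  "tail_moment j l = (LINT z|\<nu>. truncated_moment (Suc j) l z)"

definition compensated_integral :: "real \<Rightarrow> real" where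
  "compensated_integral l = (LINT z|\<nu>. compensated l z)"

text \<open>No explicit bound is used: each order inherits integrability from the function whose
  derivative it is, starting from \<open>compensated\<close>.\<close>

lemma truncated_moment_integrable: "0 < l \<Longrightarrow> integrable \<nu> (truncated_moment (Suc j) l)"
proof (induction j arbitrary: l)
  case 0
  show ?case
    by (rule LINT_parametric_derivative(1)[where a=0 and g=compensated, OF compensated_integrable compensated_derivative truncated_moment_nonneg truncated_moment_antimono 0])
next
  case (Suc j)
  show ?case
    by (rule LINT_parametric_derivative(1)[where a=0 and g="truncated_moment (Suc j)", OF Suc.IH truncated_moment_derivative truncated_moment_nonneg truncated_moment_antimono Suc.prems])
qed

lemma compensated_integral_derivative: "0 < l \<Longrightarrow> (compensated_integral has_real_derivative - tail_moment 0 l) (at l)"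
  unfolding compensated_integral_def[abs_def] tail_moment_def
  by (rule LINT_parametric_derivative(2)[where a=0 and g=compensated, OF compensated_integrable compensated_derivative truncated_moment_nonneg truncated_moment_antimono])

lemma tail_moment_derivative: "0 < l \<Longrightarrow> (tail_moment j has_real_derivative - tail_moment (Suc j) l) (at l)"
  unfolding tail_moment_def[abs_def]
  by (rule LINT_parametric_derivative(2)[where a=0 and g="truncated_moment (Suc j)", OF truncated_moment_integrable truncated_moment_derivative truncated_moment_nonneg truncated_moment_antimono])

lemma tail_moment_alternating: "alternating 0 n (tail_moment j)"
proof (rule alternating_sequence)
  show "0 \<le> tail_moment j l" for j l unfolding tail_moment_def by (intro integral_nonneg_AE AE_I2 truncated_moment_nonneg)
qed (rule tail_moment_derivative)

lemma compensated_integral_antimono: "0 < l \<Longrightarrow> l \<le> l' \<Longrightarrow> compensated_integral l' \<le> compensated_integral l"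
  unfolding compensated_integral_def using truncated_moment_antimono by (intro integral_mono compensated_integrable) (auto simp: compensated_def)

lemma laplace_exponent_eq:
  assumes l: "0 < l"
  shows "laplace_exponent \<gamma> \<sigma> \<nu> l = l * (\<gamma> + \<sigma>\<^sup>2 * l / 2 - compensated_integral l)"
proof -
  have "(LINT z|\<nu>. exp (- l * z) - 1 + l * z * indicator {0<..<1} z) = (LINT z|\<nu>. - l * compensated l z)"
  proof (rule integral_cong_AE)
    \<comment> \<open>The identity fails for negative \<open>z\<close>, where
      \<open>truncated_moment\<close> is zero; \<nu> does not charge that half-line.\<close>
    show "AE z in \<nu>. exp (- l * z) - 1 + l * z * indicator {0<..<1} z = - l * compensated l z"
      using AE_pos by eventually_elim (use l in \<open>auto simp: compensated_def truncated_moment_0 field_simps\<close>)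
    show "(\<lambda>z. - l * compensated l z) \<in> borel_measurable \<nu>"
      using borel_measurable_integrable[OF compensated_integrable[OF l]] by simp
  qed simp
  also have "\<dots> = - l * compensated_integral l" by (simp add: compensated_integral_def)
  finally show ?thesis unfolding laplace_exponent_def by (simp add: algebra_simps power2_eq_square)
qed

text \<open>The limits of \<open>compensated_integral\<close> at infinity rest on the fact that
  \<open>compensated l z\<close> decreases to \<open>- z * indicator {0<..<1} z\<close> as \<open>l\<close> grows.\<close>

lemma truncated_moment_0_tendsto: "(\<lambda>n. truncated_moment 0 (real (Suc n)) z) \<longlonglongrightarrow> 0"
proof (cases "z < 0")
  case False
  have "(\<lambda>n. truncated_moment 0 (real (Suc n)) z) = (\<lambda>n. (1 - exp (- real (Suc n) * z)) * inverse (real (Suc n)))"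
    using False by (auto simp: truncated_moment_0 divide_inverse)
  moreover have "\<dots> \<longlonglongrightarrow> 0"
  proof (rule Lim_null_comparison[OF _ LIMSEQ_inverse_real_of_nat])
    show "\<forall>\<^sub>F n in sequentially. norm ((1 - exp (- real (Suc n) * z)) * inverse (real (Suc n))) \<le> inverse (real (Suc n))"
    proof (rule always_eventually, rule allI)
      fix n
      have "0 \<le> real (Suc n) * z" using False by (intro mult_nonneg_nonneg) auto
      hence "exp (- real (Suc n) * z) \<le> 1" by (simp only: mult_minus_left exp_le_one_iff neg_le_0_iff_le)
      hence "\<bar>1 - exp (- real (Suc n) * z)\<bar> \<le> 1" by (simp add: abs_if del: of_nat_Suc)
      thus "norm ((1 - exp (- real (Suc n) * z)) * inverse (real (Suc n))) \<le> inverse (real (Suc n))"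
        unfolding real_norm_def abs_mult by (simp add: mult_left_le_one_le del: of_nat_Suc)
    qed
  qed
  ultimately show ?thesis by simp
qed (simp add: truncated_moment_neg)

text \<open>With \<open>z\<close> integrable near 0 the compensator splits off, and the rest tends
  to 0, dominated by its value at \<open>l = 1\<close>.\<close>

lemma compensated_integral_tendsto:
  assumes "bounded_variation_case \<sigma> \<nu>"
  shows "(\<lambda>n. compensated_integral (real (Suc n))) \<longlonglongrightarrow> - (LINT z:{0<..<1}|\<nu>. z)"
proof -
  have z_int: "integrable \<nu> (\<lambda>z. z * indicator {0<..<1} z)"
    using assms by (simp add: bounded_variation_case_def set_integrable_def mult.commute)
  have k_int: "integrable \<nu> (truncated_moment 0 (real (Suc n)))" for n
  proof -
    have "integrable \<nu> (\<lambda>z. compensated (real (Suc n)) z + z * indicator {0<..<1} z)"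
      by (intro Bochner_Integration.integrable_add compensated_integrable z_int) simp
    thus ?thesis by (simp add: compensated_def)
  qed
  have "(\<lambda>n. LINT z|\<nu>. truncated_moment 0 (real (Suc n)) z) \<longlonglongrightarrow> (LINT z|\<nu>. 0)"
  proof (rule integral_dominated_convergence)
    show "integrable \<nu> (truncated_moment 0 (real (Suc 0)))" by (rule k_int)
    show "AE z in \<nu>. norm (truncated_moment 0 (real (Suc n)) z) \<le> truncated_moment 0 (real (Suc 0)) z" for n
      using truncated_moment_nonneg truncated_moment_antimono by (intro AE_I2) simp
  qed (use truncated_moment_0_tendsto borel_measurable_integrable[OF k_int] in auto)
  hence "(\<lambda>n. (LINT z|\<nu>. truncated_moment 0 (real (Suc n)) z) - (LINT z|\<nu>. z * indicator {0<..<1} z))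
      \<longlonglongrightarrow> 0 - (LINT z|\<nu>. z * indicator {0<..<1} z)"
    by (intro tendsto_diff tendsto_const) simp
  moreover have "compensated_integral (real (Suc n)) = (LINT z|\<nu>. truncated_moment 0 (real (Suc n)) z) - (LINT z|\<nu>. z * indicator {0<..<1} z)" for n
    unfolding compensated_integral_def compensated_def by (rule Bochner_Integration.integral_diff[OF k_int z_int])
  ultimately show ?thesis by (simp add: set_lebesgue_integral_def mult.commute)
qed

text \<open>A positive \<sigma> would make the left side grow linearly, since
  \<open>compensated_integral\<close> is bounded above. Once \<sigma> = 0, monotone convergence
  turns the bound into integrability of \<open>truncated_moment 0 1\<close>, which is comparable to
  \<open>z\<close> on (0, 1).\<close>

lemma bounded_variation_of_bounded:
  assumes bound: "\<And>n. \<sigma>\<^sup>2 * real (Suc n) / 2 - compensated_integral (real (Suc n)) \<le> L"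
  shows "bounded_variation_case \<sigma> \<nu>"
proof -
  have le1: "compensated_integral (real (Suc n)) \<le> compensated_integral 1" for n by (rule compensated_integral_antimono) auto
  have "\<sigma>\<^sup>2 = 0"
  proof (rule ccontr)
    assume "\<sigma>\<^sup>2 \<noteq> 0"
    hence s: "\<sigma>\<^sup>2 > 0" by simp
    obtain n where n: "2 * (L + compensated_integral 1) / \<sigma>\<^sup>2 < real n" using reals_Archimedean2 by blast
    have "\<sigma>\<^sup>2 * real (Suc n) \<le> 2 * (L + compensated_integral 1)" using bound[of n] le1[of n] by (simp add: field_simps)
    hence "real (Suc n) \<le> 2 * (L + compensated_integral 1) / \<sigma>\<^sup>2" using s by (simp add: pos_le_divide_eq mult.commute)
    thus False using n by simp
  qed
  hence \<sigma>0: "\<sigma> = 0" by simp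
  \<comment> \<open>The compensator cancels in this difference, which increases with
    \<open>n\<close> to \<open>truncated_moment 0 1 z\<close>.\<close>
  let ?r = "\<lambda>n z. compensated 1 z - compensated (real (Suc n)) z"
  have dec: "decseq (\<lambda>n. compensated_integral (real (Suc n)))"
    by (rule decseq_SucI, rule compensated_integral_antimono) auto
  have "\<forall>n. - L \<le> compensated_integral (real (Suc n))" using bound by (simp add: \<sigma>0) (metis minus_le_iff)
  then obtain e where e: "(\<lambda>n. compensated_integral (real (Suc n))) \<longlonglongrightarrow> e" using decseq_convergent[OF dec] by blast
  have "integrable \<nu> (truncated_moment 0 1)"
  proof (rule integral_monotone_convergence_nonneg(1))
    show "integrable \<nu> (?r n)" for n by (intro Bochner_Integration.integrable_diff compensated_integrable) auto
    show "AE z in \<nu>. mono (\<lambda>n. ?r n z)"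
      by (intro AE_I2 monoI) (auto simp: compensated_def intro!: truncated_moment_antimono)
    show "AE z in \<nu>. 0 \<le> ?r n z" for n
      by (intro AE_I2) (auto simp: compensated_def intro!: truncated_moment_antimono)
    have "(\<lambda>n. truncated_moment 0 1 z - truncated_moment 0 (real (Suc n)) z) \<longlonglongrightarrow> truncated_moment 0 1 z - 0" for z
      by (intro tendsto_diff tendsto_const truncated_moment_0_tendsto)
    thus "AE z in \<nu>. (\<lambda>n. ?r n z) \<longlonglongrightarrow> truncated_moment 0 1 z"
      by (intro AE_I2) (simp add: compensated_def)
    have "(LINT z|\<nu>. ?r n z) = compensated_integral 1 - compensated_integral (real (Suc n))" for n
      unfolding compensated_integral_def by (intro Bochner_Integration.integral_diff compensated_integrable) auto
    thus "(\<lambda>n. LINT z|\<nu>. ?r n z) \<longlonglongrightarrow> compensated_integral 1 - e"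
      using tendsto_diff[OF tendsto_const e] by simp
    have "truncated_moment 0 1 = (\<lambda>z. if z < 0 then 0 else 1 - exp (- z))" by (auto simp: truncated_moment_neg truncated_moment_0)
    thus "truncated_moment 0 1 \<in> borel_measurable \<nu>" by simp
  qed
  hence int: "integrable \<nu> (\<lambda>z. exp 1 * truncated_moment 0 1 z)" by simp
  have "integrable \<nu> (\<lambda>z. indicator {0<..<1} z *\<^sub>R z)"
  proof (rule Bochner_Integration.integrable_bound[OF int])
    show "AE z in \<nu>. norm (indicator {0<..<1} z *\<^sub>R z) \<le> norm (exp 1 * truncated_moment 0 1 z)"
    proof (rule AE_I2)
      fix z :: real
      show "norm (indicator {0<..<1} z *\<^sub>R z) \<le> norm (exp 1 * truncated_moment 0 1 z)"
      proof (cases "0 < z \<and> z < 1")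
        case True
        \<comment> \<open>Source of the factor \<open>exp 1\<close> in the dominating
          function.\<close>
        have "z \<le> exp z - 1" using exp_ge_add_one_self[of z] by linarith
        also have "\<dots> = exp z * (1 - exp (- z))" by (simp add: algebra_simps exp_minus)
        also have "\<dots> \<le> exp 1 * (1 - exp (- z))" using True by (intro mult_right_mono) auto
        also have "1 - exp (- z) = truncated_moment 0 1 z" using True by (simp add: truncated_moment_0)
        finally show ?thesis using True by (simp add: truncated_moment_nonneg)
      qed (auto simp: indicator_def)
    qed
  qed simp
  thus ?thesis using \<sigma>0 by (simp add: bounded_variation_case_def set_integrable_def)
qed

end

subsection \<open>Scale functions\<close>

text \<open>Since \<open>kappa\<close> increases to the drift in the bounded variation case,
  \<open>drift_pos\<close> is what makes it eventually positive there.\<close>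

locale levy_scale = levy_measure \<sigma> \<nu> for \<gamma> \<sigma> q :: real and \<nu> :: "real measure" and W :: "real \<Rightarrow> real" +
  assumes q_nonneg: "0 \<le> q"
    and scale: "scale_function \<gamma> \<sigma> \<nu> q W"
    and drift_pos: "bounded_variation_case \<sigma> \<nu> \<Longrightarrow> 0 < levy_drift \<gamma> \<nu>"
begin

definition kappa :: "real \<Rightarrow> real" where
  "kappa l = \<gamma> + \<sigma>\<^sup>2 * l / 2 - compensated_integral l - q / l"

definition kappa' :: "real \<Rightarrow> real" where
  "kappa' l = \<sigma>\<^sup>2 / 2 + tail_moment 0 l + q * (inverse l * inverse l)"

lemma kappa_eq: "0 < l \<Longrightarrow> laplace_exponent \<gamma> \<sigma> \<nu> l - q = l * kappa l"
  by (simp add: laplace_exponent_eq kappa_def algebra_simps)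

lemma kappa_derivative:
  assumes "0 < l"
  shows "(kappa has_real_derivative kappa' l) (at l)"
proof -
  have "((\<lambda>l. \<gamma> + \<sigma>\<^sup>2 / 2 * l - compensated_integral l - q * inverse l) has_real_derivative
      0 + \<sigma>\<^sup>2 / 2 * 1 - - tail_moment 0 l - q * (- (inverse l * 1 * inverse l))) (at l)"
    by (intro DERIV_diff DERIV_add DERIV_const DERIV_cmult DERIV_ident compensated_integral_derivative DERIV_inverse') (use assms in auto)
  thus ?thesis by (simp add: kappa_def[abs_def] kappa'_def field_simps)
qed

lemma kappa'_alternating: "0 \<le> a \<Longrightarrow> alternating a n kappa'"
  unfolding kappa'_def[abs_def]
  by (intro alternating_add alternating_const alternating_mult alternating_inverse_ident alternating_left_mono[OF tail_moment_alternating] q_nonneg) auto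

lemma kappa_mono:
  assumes "0 < l" "l \<le> l'"
  shows "kappa l \<le> kappa l'"
proof (rule DERIV_nonneg_imp_nondecreasing[OF assms(2)])
  fix r assume "l \<le> r"
  hence r: "r > 0" using assms(1) by simp
  show "\<exists>D. (kappa has_real_derivative D) (at r) \<and> 0 \<le> D"
    using kappa_derivative[OF r] alternating_nonneg[OF kappa'_alternating[of 0 0] r] by (intro exI[of _ "kappa' r"]) simp
qed

lemma q_over_tendsto: "(\<lambda>n. q / real (Suc n)) \<longlonglongrightarrow> 0"
  using tendsto_mult_left[OF LIMSEQ_inverse_real_of_nat, of q] by (simp add: divide_inverse)

lemma kappa_tendsto_drift:
  assumes "bounded_variation_case \<sigma> \<nu>"
  shows "(\<lambda>n. kappa (real (Suc n))) \<longlonglongrightarrow> levy_drift \<gamma> \<nu>"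
proof -
  have "(\<lambda>n. \<gamma> - compensated_integral (real (Suc n)) - q / real (Suc n)) \<longlonglongrightarrow> \<gamma> - - (LINT z:{0<..<1}|\<nu>. z) - 0"
    by (intro tendsto_diff tendsto_const compensated_integral_tendsto assms q_over_tendsto)
  thus ?thesis
    using assms unfolding kappa_def levy_drift_def bounded_variation_case_def by simp
qed

lemma kappa_at_top:
  assumes "\<not> bounded_variation_case \<sigma> \<nu>"
  shows "filterlim (\<lambda>n. kappa (real (Suc n))) at_top sequentially"
proof -
  have inc: "incseq (\<lambda>n. kappa (real (Suc n)))"
    by (rule incseq_SucI, rule kappa_mono) auto
  have "\<exists>n. L \<le> kappa (real (Suc n))" for L
  proof (rule ccontr)
    assume no: "\<not> (\<exists>n. L \<le> kappa (real (Suc n)))"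
    have "\<sigma>\<^sup>2 * real (Suc n) / 2 - compensated_integral (real (Suc n)) \<le> L - \<gamma> + q" for n
    proof -
      have "kappa (real (Suc n)) < L" using no by (simp add: not_le)
      moreover have "q / real (Suc n) \<le> q" using divide_left_mono[of 1 "real (Suc n)" q] q_nonneg by simp
      ultimately show ?thesis unfolding kappa_def by linarith
    qed
    thus False using bounded_variation_of_bounded assms by blast
  qed
  thus ?thesis unfolding filterlim_at_top eventually_sequentially
    using inc by (meson incseq_def order_trans)
qed

lemma kappa_pos: "\<exists>a\<ge>0. \<forall>l>a. 0 < kappa l"
proof -
  have "\<forall>\<^sub>F n in sequentially. 0 < kappa (real (Suc n))"
  proof (cases "bounded_variation_case \<sigma> \<nu>")
    case True
    show ?thesis by (rule order_tendstoD(1)[OF kappa_tendsto_drift[OF True] drift_pos[OF True]])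
  next
    case False
    show ?thesis using kappa_at_top[OF False] by (simp add: filterlim_at_top_dense)
  qed
  then obtain n where n: "0 < kappa (real (Suc n))" by (auto simp: eventually_sequentially)
  have "0 < kappa l" if "l > real (Suc n)" for l
    using n kappa_mono[of "real (Suc n)" l] that by (simp add: order_less_le_trans del: of_nat_Suc)
  thus ?thesis by (intro exI[of _ "real (Suc n)"]) auto
qed

section \<open>Regularity, monotonicity and initial value of the scale function\<close>

lemma W_neg: "x < 0 \<Longrightarrow> W x = 0"
  and W_cont: "continuous_on {0..} W"
  using scale by (auto simp: scale_function_def)

lemma W_measurable [measurable]: "W \<in> borel_measurable borel"
proof -
  have "(\<lambda>x. if x \<in> {0..} then W x else 0) \<in> borel_measurable borel"
    using W_cont by (intro borel_measurable_continuous_on_if) auto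
  also have "(\<lambda>x. if x \<in> {0..} then W x else 0) = W" using W_neg by auto
  finally show ?thesis .
qed

lemma W_isCont: "0 < x \<Longrightarrow> isCont W x"
  using W_cont by (rule continuous_on_interior) (simp add: interior_real_atLeast)

lemma laplace_W:
  obtains a where "0 \<le> a" "\<And>l. l > a \<Longrightarrow> 0 < kappa l"
    "\<And>l. l > a \<Longrightarrow> integrable lborel (\<lambda>y. indicator {0..} y * (exp (- l * y) * W y))"
    "\<And>l. l > a \<Longrightarrow> l * laplace_moment W 0 l = inverse (kappa l)"
proof -
  obtain a1 where a1: "0 \<le> a1" "\<And>l. l > a1 \<Longrightarrow> 0 < kappa l" using kappa_pos by blast
  obtain a2 where a2: "\<And>l. l \<ge> a2 \<Longrightarrow> set_integrable lborel {0..} (\<lambda>y. exp (- l * y) * W y) \<and>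
        (LINT y:{0..}|lborel. exp (- l * y) * W y) = 1 / (laplace_exponent \<gamma> \<sigma> \<nu> l - q)"
    using scale by (auto simp: scale_function_def eventually_at_top_linorder)
  show thesis
  proof (rule that[of "max a1 a2"])
    fix l assume l: "l > max a1 a2"
    hence l0: "l > 0" using a1 by simp
    have *: "set_integrable lborel {0..} (\<lambda>y. exp (- l * y) * W y)"
      "(LINT y:{0..}|lborel. exp (- l * y) * W y) = 1 / (l * kappa l)"
      using a2[of l] l kappa_eq[OF l0] by auto
    show "integrable lborel (\<lambda>y. indicator {0..} y * (exp (- l * y) * W y))"
      using *(1) by (simp add: set_integrable_def)
    have "laplace_moment W 0 l = 1 / (l * kappa l)"
      using *(2) by (simp add: laplace_moment_def set_lebesgue_integral_def)
    thus "l * laplace_moment W 0 l = inverse (kappa l)" using l0 by (simp add: field_simps)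
  qed (use a1 in auto)
qed

text \<open>Since \<open>l * kappa l = \<psi> l - q\<close>, the transform of the measure \<open>dW\<close> is \<open>1 / kappa\<close>, and it is
  completely monotone because \<open>kappa'\<close> is.\<close>

lemma W_mono_pos:
  assumes "0 < x" "x \<le> y"
  shows "W x \<le> W y"
proof -
  obtain a where a: "0 \<le> a" "\<And>l. l > a \<Longrightarrow> 0 < kappa l"
    "\<And>l. l > a \<Longrightarrow> integrable lborel (\<lambda>y. indicator {0..} y * (exp (- l * y) * W y))"
    "\<And>l. l > a \<Longrightarrow> l * laplace_moment W 0 l = inverse (kappa l)"
    by (rule laplace_W) (rule that; simp)
  have cm: "alternating a n (\<lambda>l. inverse (kappa l))" for n
    by (rule alternating_inverse[where p'=kappa']) (use a(1,2) in \<open>auto intro: kappa_derivative kappa'_alternating\<close>)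
  have alternating_W: "alternating a n (\<lambda>l. l * laplace_moment W 0 l)" for n
    by (rule alternating_cong[OF cm a(4)])
  show ?thesis
    by (rule mono_of_laplace_alternating[OF W_measurable a(3) a(1) alternating_W assms]) (use assms in \<open>auto intro: W_isCont\<close>)
qed

lemma W_tendsto_0: "(W \<longlongrightarrow> W 0) (at_right 0)"
proof (rule tendsto_within_subset)
  show "(W \<longlongrightarrow> W 0) (at 0 within {0..})" using W_cont by (simp add: continuous_on_def)
qed auto

lemma W_mono: "0 \<le> x \<Longrightarrow> x \<le> y \<Longrightarrow> W x \<le> W y"
proof (cases "x = 0")
  case True
  show "0 \<le> x \<Longrightarrow> x \<le> y \<Longrightarrow> W x \<le> W y"
  proof (cases "y = 0")
    case False
    assume "0 \<le> x" "x \<le> y"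
    hence y: "0 < y" using True False by simp
    have "\<forall>\<^sub>F t in at_right 0. W t \<le> W y"
      unfolding eventually_at_right_field using y by (intro exI[of _ y]) (auto intro: W_mono_pos)
    thus "W x \<le> W y" unfolding True by (intro tendsto_upperbound[OF W_tendsto_0]) auto
  qed (use True in auto)
qed (auto intro: W_mono_pos)

text \<open>Substituting \<open>s = l * y\<close> turns the left side into the mean of
  \<open>W (s / l)\<close> for a standard exponential \<open>s\<close>, whose argument tends to 0 as
  \<open>l\<close> grows.\<close>

lemma initial_value: "(\<lambda>n. real (Suc n) * laplace_moment W 0 (real (Suc n))) \<longlonglongrightarrow> W 0"
proof -
  obtain a where a: "0 \<le> a"
    "\<And>l. l > a \<Longrightarrow> integrable lborel (\<lambda>y. indicator {0..} y * (exp (- l * y) * W y))"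
    by (rule laplace_W) (rule that; simp)
  have subst: "integrable lborel (\<lambda>s. indicator {0..} s * (exp (- s) * W (s / l)))"
    "l * laplace_moment W 0 l = (LINT s|lborel. indicator {0..} s * (exp (- s) * W (s / l)))"
    if l: "l > a" for l
  proof -
    have l0: "l > 0" using l a by simp
    let ?f = "\<lambda>y. indicator {0..} y * (exp (- l * y) * W y) :: real"
    have eq: "(\<lambda>s. ?f (0 + (1 / l) * s)) = (\<lambda>s. indicator {0..} s * (exp (- s) * W (s / l)))"
      using l0 by (auto simp: indicator_def zero_le_divide_iff)
    show "integrable lborel (\<lambda>s. indicator {0..} s * (exp (- s) * W (s / l)))"
      using lborel_integrable_real_affine[OF a(2)[OF l], of "1 / l" 0] l0 unfolding eq by simp
    show "l * laplace_moment W 0 l = (LINT s|lborel. indicator {0..} s * (exp (- s) * W (s / l)))"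
      using lborel_integral_real_affine[of "1 / l" ?f 0] l0 unfolding eq by (simp add: laplace_moment_def)
  qed
  obtain N where N: "real N > a" using reals_Archimedean2 by blast
  have erlang_eq: "erlang_density 0 1 = (\<lambda>s. indicator {0..} s * exp (- s))"
    by (auto simp: erlang_density_def indicator_def fun_eq_iff)
  have int_exp: "integrable lborel (\<lambda>s. indicator {0..} s * exp (- s) :: real)"
    unfolding erlang_eq[symmetric] by (rule erlang_density_integral) simp
  let ?l = "\<lambda>n. real (Suc (n + N))"
  have l: "?l n > a" for n using N by simp
  have "(\<lambda>n. LINT s|lborel. indicator {0..} s * (exp (- s) * W (s / ?l n)))
     \<longlonglongrightarrow> (LINT s|lborel. indicator {0..} s * (exp (- s) * W 0))"
  proof (rule integral_dominated_convergence)
    \<comment> \<open>Monotonicity puts \<open>W (s / ?l n)\<close> between \<open>W 0\<close> and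
      \<open>W (s / ?l 0)\<close>. Absolute values are taken because the sign of \<open>W 0\<close>
      is deduced only from this limit.\<close>
    show "integrable lborel (\<lambda>s. indicator {0..} s * exp (- s) * \<bar>W 0\<bar> + \<bar>indicator {0..} s * (exp (- s) * W (s / ?l 0))\<bar>)"
      by (intro Bochner_Integration.integrable_add integrable_mult_left int_exp integrable_abs subst l)
    show "AE s in lborel. (\<lambda>n. indicator {0..} s * (exp (- s) * W (s / ?l n))) \<longlonglongrightarrow> indicator {0..} s * (exp (- s) * W 0)"
    proof (intro AE_I2)
      fix s :: real
      have "(\<lambda>n. W (s / ?l n)) \<longlonglongrightarrow> W 0" if s: "s > 0"
      proof (rule filterlim_compose[OF W_tendsto_0])
        have "(\<lambda>n. s * inverse (?l n)) \<longlonglongrightarrow> s * 0"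
          by (intro tendsto_mult_left LIMSEQ_ignore_initial_segment[OF LIMSEQ_inverse_real_of_nat])
        thus "filterlim (\<lambda>n. s / ?l n) (at_right 0) sequentially"
          using s unfolding filterlim_at by (auto simp: divide_inverse)
      qed
      thus "(\<lambda>n. indicator {0..} s * (exp (- s) * W (s / ?l n))) \<longlonglongrightarrow> indicator {0..} s * (exp (- s) * W 0)"
        by (cases "s > 0"; cases "s = 0") (auto intro!: tendsto_intros simp: indicator_def)
    qed
    show "AE s in lborel. norm (indicator {0..} s * (exp (- s) * W (s / ?l n)))
        \<le> indicator {0..} s * exp (- s) * \<bar>W 0\<bar> + \<bar>indicator {0..} s * (exp (- s) * W (s / ?l 0))\<bar>" for n
    proof (intro AE_I2)
      fix s :: real
      show "norm (indicator {0..} s * (exp (- s) * W (s / ?l n)))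
        \<le> indicator {0..} s * exp (- s) * \<bar>W 0\<bar> + \<bar>indicator {0..} s * (exp (- s) * W (s / ?l 0))\<bar>"
      proof (cases "s \<ge> 0")
        case True
        have "W 0 \<le> W (s / ?l n)" using True by (intro W_mono) auto
        moreover have "W (s / ?l n) \<le> W (s / ?l 0)" using True by (intro W_mono divide_left_mono) auto
        ultimately have "\<bar>W (s / ?l n)\<bar> \<le> \<bar>W 0\<bar> + \<bar>W (s / ?l 0)\<bar>" by linarith
        hence "exp (- s) * \<bar>W (s / ?l n)\<bar> \<le> exp (- s) * (\<bar>W 0\<bar> + \<bar>W (s / ?l 0)\<bar>)"
          by (rule mult_left_mono) simp
        thus ?thesis using True by (simp add: abs_mult distrib_left)
      qed simp
    qed
  qed simp_all
  also have "(LINT s|lborel. indicator {0..} s * (exp (- s) * W 0)) = W 0"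
  proof -
    have "(LINT s|lborel. indicator {0..} s * exp (- s)) = (1::real)"
      unfolding erlang_eq[symmetric] by (rule erlang_density_integral) simp
    thus ?thesis by (simp add: mult.assoc[symmetric])
  qed
  finally have "(\<lambda>n. ?l n * laplace_moment W 0 (?l n)) \<longlonglongrightarrow> W 0"
    using subst(2)[OF l] by simp
  thus ?thesis by (rule LIMSEQ_offset)
qed

lemma inverse_kappa_tendsto: "(\<lambda>n. inverse (kappa (real (Suc n)))) \<longlonglongrightarrow> W 0"
proof -
  obtain a where a: "\<And>l. l > a \<Longrightarrow> l * laplace_moment W 0 l = inverse (kappa l)"
    by (rule laplace_W) (rule that; simp)
  obtain N where N: "real N > a" using reals_Archimedean2 by blast
  have "\<forall>\<^sub>F n in sequentially. real (Suc n) * laplace_moment W 0 (real (Suc n)) = inverse (kappa (real (Suc n)))"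
    unfolding eventually_sequentially
  proof (intro exI allI impI)
    fix n assume "N \<le> n"
    hence "real (Suc n) > a" using N by simp
    thus "real (Suc n) * laplace_moment W 0 (real (Suc n)) = inverse (kappa (real (Suc n)))" by (rule a)
  qed
  thus ?thesis by (rule Lim_transform_eventually[OF initial_value])
qed

lemma W_0_bounded_variation:
  assumes "bounded_variation_case \<sigma> \<nu>"
  shows "W 0 = inverse (levy_drift \<gamma> \<nu>)"
  by (rule LIMSEQ_unique[OF inverse_kappa_tendsto tendsto_inverse[OF kappa_tendsto_drift[OF assms]]])
    (use drift_pos[OF assms] in simp)

lemma W_0_unbounded_variation:
  assumes "\<not> bounded_variation_case \<sigma> \<nu>"
  shows "W 0 = 0"
  by (rule LIMSEQ_unique[OF inverse_kappa_tendsto tendsto_inverse_0_at_top[OF kappa_at_top[OF assms]]])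

lemma W_0_nonneg: "0 \<le> W 0"
  using W_0_bounded_variation W_0_unbounded_variation drift_pos
  by (cases "bounded_variation_case \<sigma> \<nu>") (auto intro: less_imp_le)

lemma W_nonneg: "0 \<le> W x"
  using W_neg[of x] W_mono[of 0 x] W_0_nonneg by (cases "x < 0") auto

section \<open>The right derivative of the scale function as a kernel\<close>

lemma right_derivative_nonneg:
  assumes "right_derivative W W'" "0 < x"
  shows "0 \<le> W' x"
proof -
  have "((\<lambda>y. (W y - W x) / (y - x)) \<longlongrightarrow> W' x) (at_right x)"
    using assms by (simp add: right_derivative_def has_field_derivative_iff)
  moreover have "\<forall>\<^sub>F y in at_right x. 0 \<le> (W y - W x) / (y - x)"
    using assms(2) by (intro eventually_at_rightI[of x "x + 1"]) (auto intro!: divide_nonneg_pos W_mono)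
  ultimately show ?thesis by (intro tendsto_lowerbound) auto
qed

text \<open>A countable family of measurable difference quotients, serving both the measurability of
  the kernel and Fatou's lemma.\<close>

lemma right_derivative_sequence:
  assumes "right_derivative W W'" "0 < x"
  shows "(\<lambda>n. real (Suc n) * (W (x + inverse (real (Suc n))) - W x)) \<longlonglongrightarrow> W' x"
proof -
  have "((\<lambda>y. (W y - W x) / (y - x)) \<longlongrightarrow> W' x) (at_right x)"
    using assms by (simp add: right_derivative_def has_field_derivative_iff)
  moreover have "filterlim (\<lambda>n. x + inverse (real (Suc n))) (at_right x) sequentially"
    unfolding filterlim_at using tendsto_add[OF tendsto_const LIMSEQ_inverse_real_of_nat, of x]
    by (auto simp: add_pos_pos)
  ultimately have "(\<lambda>n. (W (x + inverse (real (Suc n))) - W x) / (x + inverse (real (Suc n)) - x)) \<longlonglongrightarrow> W' x"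
    by (rule filterlim_compose)
  thus ?thesis by (simp add: mult.commute divide_inverse)
qed

text \<open>The integrals over the common part of \<open>{0..1}\<close> and its shift cancel. What
  remains is an integral over \<open>{1..1 + h}\<close>, where \<open>W \<le> W 2\<close>, minus a
  nonnegative one over \<open>{0..h}\<close>.\<close>

lemma W_increment_integral:
  assumes h: "0 < h" "h \<le> 1"
  shows "(\<integral>\<^sup>+ x. ennreal (W (x + h) - W x) * indicator {0..1} x \<partial>lborel) \<le> ennreal (h * W 2)"
proof -
  have cont: "continuous_on {u..v} W" if "0 \<le> u" for u v
    using W_cont by (rule continuous_on_subset) (use that in auto)
  have W_int: "W integrable_on {u..v}" if "0 \<le> u" for u v
    by (rule integrable_continuous_real[OF cont[OF that]])
  have shift: "((\<lambda>x. W (x + h)) has_integral integral {h..1 + h} W) {0..1}"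
  proof -
    have c: "continuous_on {0..1} (\<lambda>x. W (x + h))"
      using h by (intro continuous_on_compose2[OF W_cont] continuous_intros) auto
    have "integral {0..1} (\<lambda>x. W (x + h)) = integral {h..1 + h} W"
      using integral_shift_real_ivl[of h h "1 + h" W] by simp
    thus ?thesis using integrable_integral[OF integrable_continuous_real[OF c]] by simp
  qed
  have "integral {h..1 + h} W - integral {0..1} W = integral {1..1 + h} W - integral {0..h} W"
    using Henstock_Kurzweil_Integration.integral_combine[of h 1 "1 + h" W]
      Henstock_Kurzweil_Integration.integral_combine[of 0 h 1 W] h W_int by simp
  also have "integral {0..h} W \<ge> 0" using W_int W_nonneg by (intro integral_nonneg) auto
  hence "integral {1..1 + h} W - integral {0..h} W \<le> integral {1..1 + h} W" by simp
  also have "\<dots> \<le> integral {1..1 + h} (\<lambda>_. W 2)"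
    using h by (intro integral_le W_int integrable_const_ivl W_mono) auto
  also have "\<dots> = h * W 2" using h by simp
  finally have le: "integral {h..1 + h} W - integral {0..1} W \<le> h * W 2" .
  have "((\<lambda>x. W (x + h) - W x) has_integral integral {h..1 + h} W - integral {0..1} W) {0..1}"
    by (intro has_integral_diff shift integrable_integral W_int) simp
  hence "(\<integral>\<^sup>+ x. ennreal (W (x + h) - W x) * indicator {0..1} x \<partial>lborel)
     = ennreal (integral {h..1 + h} W - integral {0..1} W)"
    using h by (intro nn_integral_has_integral_lebesgue') (auto intro: W_mono)
  thus ?thesis using le by (simp add: ennreal_leI)
qed

lemma right_derivative_integrable:
  assumes "right_derivative W W'"
  shows "(\<integral>\<^sup>+ x. ennreal (W' x) * indicator {0<..<1} x \<partial>lborel) < \<infinity>"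
proof -
  let ?d = "\<lambda>n x. ennreal (real (Suc n) * (W (x + inverse (real (Suc n))) - W x)) * indicator {0<..<1} x"
  have "(\<integral>\<^sup>+ x. ennreal (W' x) * indicator {0<..<1} x \<partial>lborel) = (\<integral>\<^sup>+ x. liminf (\<lambda>n. ?d n x) \<partial>lborel)"
  proof (intro nn_integral_cong)
    fix x :: real
    show "ennreal (W' x) * indicator {0<..<1} x = liminf (\<lambda>n. ?d n x)"
    proof (cases "0 < x \<and> x < 1")
      case True
      have "(\<lambda>n. ennreal (real (Suc n) * (W (x + inverse (real (Suc n))) - W x))) \<longlonglongrightarrow> ennreal (W' x)"
        using True by (intro tendsto_ennrealI right_derivative_sequence[OF assms]) auto
      hence "(\<lambda>n. ?d n x) \<longlonglongrightarrow> ennreal (W' x)" using True by simp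
      from lim_imp_Liminf[OF sequentially_bot this]
      have "liminf (\<lambda>n. ?d n x) = ennreal (W' x)" .
      moreover have "ennreal (W' x) * indicator {0<..<1} x = ennreal (W' x)" using True by simp
      ultimately show ?thesis by (simp only:)
    qed (auto simp: Liminf_const)
  qed
  also have "\<dots> \<le> liminf (\<lambda>n. \<integral>\<^sup>+ x. ?d n x \<partial>lborel)"
    by (rule nn_integral_liminf) measurable
  also have "\<dots> \<le> liminf (\<lambda>n. ennreal (W 2))"
  proof (intro Liminf_mono always_eventually allI)
    fix n
    let ?h = "inverse (real (Suc n))"
    have "(\<integral>\<^sup>+ x. ?d n x \<partial>lborel) \<le> (\<integral>\<^sup>+ x. ennreal (real (Suc n)) * (ennreal (W (x + ?h) - W x) * indicator {0..1} x) \<partial>lborel)"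
      by (intro nn_integral_mono) (auto simp: ennreal_mult' indicator_def)
    also have "\<dots> = ennreal (real (Suc n)) * (\<integral>\<^sup>+ x. ennreal (W (x + ?h) - W x) * indicator {0..1} x \<partial>lborel)"
      by (rule nn_integral_cmult) measurable
    also have "\<dots> \<le> ennreal (real (Suc n)) * ennreal (?h * W 2)"
      by (intro mult_left_mono W_increment_integral) (auto simp: inverse_le_1_iff)
    also have "\<dots> = ennreal (real (Suc n) * (?h * W 2))"
      by (rule ennreal_mult'[symmetric]) simp
    also have "real (Suc n) * (?h * W 2) = W 2" by (simp add: field_simps)
    finally show "(\<integral>\<^sup>+ x. ?d n x \<partial>lborel) \<le> ennreal (W 2)" .
  qed
  also have "\<dots> = ennreal (W 2)" by (simp add: Liminf_const)
  finally show ?thesis by (simp add: order.strict_trans1)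
qed

end

subsection \<open>Stability of the Volterra equations\<close>

lemma step_rate_measurable: "step_rate \<phi> \<Longrightarrow> \<phi> \<in> borel_measurable borel"
  and step_rate_nonneg: "step_rate \<phi> \<Longrightarrow> 0 \<le> \<phi> x"
proof -
  assume "step_rate \<phi>"
  then obtain k :: nat and \<delta> b where \<delta>: "\<And>j. j \<in> {1..k} \<Longrightarrow> 0 < \<delta> j"
    and \<phi>: "\<And>x. \<phi> x = (\<Sum>j=1..k. \<delta> j * indicator {b j<..} x)"
    unfolding step_rate_def by blast
  have "\<phi> = (\<lambda>x. \<Sum>j=1..k. \<delta> j * indicator {b j<..} x)" using \<phi> by (rule ext)
  moreover have "(\<lambda>x. \<Sum>j=1..k. \<delta> j * indicator {b j<..} x) \<in> borel_measurable borel"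
    by (intro borel_measurable_sum borel_measurable_times borel_measurable_const borel_measurable_indicator) auto
  ultimately show "\<phi> \<in> borel_measurable borel" by (simp only:)
  show "0 \<le> \<phi> x" unfolding \<phi> using \<delta> by (intro sum_nonneg mult_nonneg_nonneg) (auto intro: less_imp_le)
qed

locale levy_volterra = levy_scale \<gamma> \<sigma> q \<nu> W
  for \<gamma> \<sigma> q :: real and \<nu> :: "real measure" and W :: "real \<Rightarrow> real" +
  fixes W' \<phi> :: "real \<Rightarrow> real" and \<phi>s :: "nat \<Rightarrow> real \<Rightarrow> real"
  assumes W': "right_derivative W W'"
    and rate: "rate_function \<gamma> \<sigma> \<nu> \<phi>"
    and approx: "approximating_sequence \<phi> \<phi>s"
begin

definition K :: "real \<Rightarrow> real" where
  "K x = (if 0 < x then W' x else 0)"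

lemma K_measurable: "K \<in> borel_measurable borel"
proof (rule borel_measurable_LIMSEQ_real)
  fix x :: real
  show "(\<lambda>n. if 0 < x then real (Suc n) * (W (x + inverse (real (Suc n))) - W x) else 0) \<longlonglongrightarrow> K x"
    unfolding K_def using right_derivative_sequence[OF W', of x] by (cases "0 < x") simp_all
qed measurable

lemma K_nonneg: "0 \<le> K x"
  using right_derivative_nonneg[OF W'] by (simp add: K_def)

lemma K_integrable: "(\<integral>\<^sup>+ x. ennreal (K x) * indicator {0<..<1} x \<partial>lborel) < \<infinity>"
proof -
  have "(\<integral>\<^sup>+ x. ennreal (K x) * indicator {0<..<1} x \<partial>lborel) = (\<integral>\<^sup>+ x. ennreal (W' x) * indicator {0<..<1} x \<partial>lborel)"
    by (rule nn_integral_cong) (auto simp: K_def indicator_def)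
  thus ?thesis using right_derivative_integrable[OF W'] by simp
qed

lemma kernel:
  assumes "\<And>x. x > d \<Longrightarrow> 0 \<le> h x"
  shows "volterra_kernel K h d"
  by unfold_locales (use assms K_measurable K_nonneg K_integrable in \<open>simp_all add: K_def\<close>)

lemma rate_mono: "x \<le> y \<Longrightarrow> \<phi> x \<le> \<phi> y"
  using rate by (simp add: rate_function_def mono_def)

lemma rate_nonneg: "0 \<le> \<phi> x"
proof -
  obtain d' where "\<And>x. x \<le> d' \<Longrightarrow> \<phi> x = 0" using rate unfolding rate_function_def by blast
  thus ?thesis using rate_mono[of "min x d'" x] by simp
qed

lemma Xi_pos: "0 < Xi W \<phi> x"
proof (cases "bounded_variation_case \<sigma> \<nu>")
  case True
  have "\<phi> x < levy_drift \<gamma> \<nu>" using rate True by (simp add: rate_function_def)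
  thus ?thesis using drift_pos[OF True] by (simp add: Xi_def W_0_bounded_variation[OF True] field_simps)
next
  case False
  thus ?thesis by (simp add: Xi_def W_0_unbounded_variation)
qed

text \<open>The shift to \<open>Suc n\<close> reflects that the entry at 0 of an approximating
  sequence is unconstrained.\<close>

lemma approx_step: "step_rate (\<phi>s (Suc n))"
  and approx_le: "\<phi>s (Suc n) x \<le> \<phi> x"
  and approx_mono: "\<phi>s (Suc n) x \<le> \<phi>s (Suc (Suc n)) x"
  using approx by (simp_all add: approximating_sequence_def)

lemma approx_tendsto: "(\<lambda>n. \<phi>s (Suc n) x) \<longlonglongrightarrow> \<phi> x"
proof -
  have "compact {x} \<longrightarrow> uniform_limit {x} \<phi>s \<phi> sequentially"
    using approx unfolding approximating_sequence_def by (elim conjE) (rule spec)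
  hence "(\<lambda>n. \<phi>s n x) \<longlonglongrightarrow> \<phi> x" by simp
  thus ?thesis by (rule LIMSEQ_Suc)
qed

lemma Xi_antimono: "f x \<le> f' x \<Longrightarrow> Xi W f' x \<le> Xi W f x"
  using W_0_nonneg by (simp add: Xi_def mult_left_mono)

lemma Xi_approx_pos: "0 < Xi W (\<phi>s (Suc n)) x"
  using Xi_pos[of x] Xi_antimono[of "\<phi>s (Suc n)" x \<phi>] approx_le[of n x] by linarith

lemma inverse_Xi_approx_le: "inverse (Xi W (\<phi>s (Suc n)) x) \<le> inverse (Xi W \<phi> x)"
  by (rule le_imp_inverse_le[OF Xi_antimono Xi_pos]) (rule approx_le)

lemma inverse_Xi_approx_mono: "inverse (Xi W (\<phi>s (Suc n)) x) \<le> inverse (Xi W (\<phi>s (Suc (Suc n))) x)"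
  by (rule le_imp_inverse_le[OF Xi_antimono Xi_approx_pos]) (rule approx_mono)

lemma inverse_Xi_approx_tendsto: "(\<lambda>n. inverse (Xi W (\<phi>s (Suc n)) x)) \<longlonglongrightarrow> inverse (Xi W \<phi> x)"
proof (rule tendsto_inverse)
  show "(\<lambda>n. Xi W (\<phi>s (Suc n)) x) \<longlonglongrightarrow> Xi W \<phi> x"
    unfolding Xi_def by (intro tendsto_diff tendsto_const tendsto_mult approx_tendsto)
qed (use Xi_pos[of x] in simp)

lemma coefficients_bounded: "\<exists>B. \<forall>x\<le>b. \<phi> x \<le> B \<and> inverse (Xi W \<phi> x) \<le> B"
proof (intro exI allI impI conjI)
  fix x assume x: "x \<le> b"
  have "inverse (Xi W \<phi> x) \<le> inverse (Xi W \<phi> b)"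
    unfolding Xi_def using mult_left_mono[OF rate_mono[OF x] W_0_nonneg] Xi_pos[of b]
    by (intro le_imp_inverse_le) (simp_all add: Xi_def)
  thus "inverse (Xi W \<phi> x) \<le> max (\<phi> b) (inverse (Xi W \<phi> b))" by simp
  show "\<phi> x \<le> max (\<phi> b) (inverse (Xi W \<phi> b))" using rate_mono[OF x] by simp
qed

text \<open>The solutions are cut off to the left of \<open>d\<close>, and the
  factor \<open>1 / \<Xi> x\<close>, which is constant in the integration variable, is pulled out.\<close>

lemma solution_tendsto:
  assumes h: "\<And>x. x > d \<Longrightarrow> 0 \<le> h x"
    and sol: "\<And>f u. solves f u \<Longrightarrow> set_borel_measurable lborel {d<..} u"
      "\<And>f u x. solves f u \<Longrightarrow> x > d \<Longrightarrow>
        set_integrable lborel {d<..<x} (\<lambda>y. inverse (Xi W f x) * f y * W' (x - y) * u y) \<and>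
        u x = inverse (Xi W f x) * h x + (LINT y:{d<..<x}|lborel. inverse (Xi W f x) * f y * W' (x - y) * u y)"
    and u: "solves \<phi> u" "\<And>n. solves (\<phi>s (Suc n)) (us (Suc n))"
    and x: "x > d"
  shows "(\<lambda>n. us n x) \<longlonglongrightarrow> u x"
proof -
  interpret V: volterra_kernel K h d by (rule kernel) (rule h)
  define cut where "cut v x = (if x > d then v x else 0)" for v :: "real \<Rightarrow> real" and x
  have int_eq: "indicator {d<..<x} y *\<^sub>R (inverse (Xi W f x) * f y * W' (x - y) * v y)
      = inverse (Xi W f x) * (f y * cut v y * K (x - y))" for f v x y
    by (auto simp: cut_def K_def indicator_def)
  have V_sol: "V.sol f (\<lambda>x. inverse (Xi W f x)) (cut v)"
    if s: "solves f v" and pos: "\<And>x. 0 < Xi W f x" for f v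
    unfolding V.sol_def
  proof (intro conjI allI impI)
    have "(\<lambda>x. indicator {d<..} x *\<^sub>R v x) \<in> borel_measurable borel"
      using sol(1)[OF s] by (simp add: set_borel_measurable_def)
    also have "(\<lambda>x. indicator {d<..} x *\<^sub>R v x) = cut v" by (auto simp: cut_def indicator_def)
    finally show "cut v \<in> borel_measurable borel" .
    show "cut v x = 0" if "x \<le> d" for x using that by (simp add: cut_def)
    show "integrable lborel (\<lambda>y. f y * cut v y * K (x - y))" for x
    proof (cases "x > d")
      case True
      have "integrable lborel (\<lambda>y. inverse (Xi W f x) * (f y * cut v y * K (x - y)))"
        using sol(2)[OF s True] unfolding set_integrable_def int_eq by simp
      \<comment> \<open>Positivity of \<open>Xi\<close> matters here: with
        \<open>inverse 0 = 0\<close> the given integrability would say nothing about the convolution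
        itself.\<close>
      hence "integrable lborel (\<lambda>y. Xi W f x * (inverse (Xi W f x) * (f y * cut v y * K (x - y))))"
        by (rule integrable_mult_right)
      thus ?thesis using pos[of x] by (simp add: mult.assoc[symmetric])
    next
      case False
      have "(\<lambda>y. f y * cut v y * K (x - y)) = (\<lambda>_. 0)"
        using False by (auto simp: cut_def K_def)
      thus ?thesis by simp
    qed
    show "cut v x = inverse (Xi W f x) * (h x + (LINT y|lborel. f y * cut v y * K (x - y)))" if "x > d" for x
    proof -
      have "v x = inverse (Xi W f x) * h x + (LINT y|lborel. inverse (Xi W f x) * (f y * cut v y * K (x - y)))"
        using sol(2)[OF s that] unfolding set_lebesgue_integral_def int_eq by simp
      thus ?thesis using that by (simp add: cut_def[of v x] distrib_left)
    qed
  qed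
  have coeff: "V.coeff \<phi> (\<lambda>x. inverse (Xi W \<phi> x))"
    unfolding V.coeff_def
  proof (intro conjI allI)
    show "\<phi> \<in> borel_measurable borel" by (rule borel_measurable_mono) (simp add: mono_def rate_mono)
    show "0 \<le> inverse (Xi W \<phi> x)" for x using Xi_pos[of x] by simp
  qed (rule rate_nonneg coefficients_bounded)+
  have coeff_n: "V.coeff (\<phi>s (Suc n)) (\<lambda>x. inverse (Xi W (\<phi>s (Suc n)) x))" for n
    unfolding V.coeff_def
  proof (intro conjI allI)
    show "0 \<le> inverse (Xi W (\<phi>s (Suc n)) x)" for x using Xi_approx_pos[of n x] by simp
    show "\<exists>B. \<forall>x\<le>b. \<phi>s (Suc n) x \<le> B \<and> inverse (Xi W (\<phi>s (Suc n)) x) \<le> B" for b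
    proof -
      obtain B where "\<And>x. x \<le> b \<Longrightarrow> \<phi> x \<le> B \<and> inverse (Xi W \<phi> x) \<le> B"
        using coefficients_bounded by blast
      hence "\<forall>x\<le>b. \<phi>s (Suc n) x \<le> B \<and> inverse (Xi W (\<phi>s (Suc n)) x) \<le> B"
        by (meson approx_le inverse_Xi_approx_le order_trans)
      thus ?thesis by (rule exI)
    qed
  qed (rule step_rate_measurable step_rate_nonneg approx_step)+
  have "(\<lambda>n. cut (us (Suc n)) x) \<longlonglongrightarrow> cut u x"
    by (rule V.sol_tendsto[OF coeff coeff_n V_sol[OF u(1) Xi_pos] V_sol[OF u(2) Xi_approx_pos]
        approx_mono inverse_Xi_approx_mono approx_le inverse_Xi_approx_le approx_tendsto inverse_Xi_approx_tendsto])
  hence "(\<lambda>n. us (Suc n) x) \<longlonglongrightarrow> u x" using x by (simp add: cut_def)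
  thus ?thesis by (rule LIMSEQ_imp_Suc)
qed

lemma w_solution_tendsto:
  assumes "w_solution W W' \<phi> d w" and "\<And>n. n \<ge> 1 \<Longrightarrow> w_solution W W' (\<phi>s n) d (ws n)" and "x > d"
  shows "(\<lambda>n. ws n x) \<longlonglongrightarrow> w x"
proof (rule solution_tendsto[where solves="\<lambda>f u. w_solution W W' f d u" and d=d and h="\<lambda>x. W' (x - d)"
      and us=ws and u=w and x=x])
  show "0 \<le> W' (x - d)" if "x > d" for x using that by (intro right_derivative_nonneg[OF W']) simp
  show "set_borel_measurable lborel {d<..} u" if "w_solution W W' f d u" for f u
    using that unfolding w_solution_def by (rule conjunct1)
  show "set_integrable lborel {d<..<x} (\<lambda>y. inverse (Xi W f x) * f y * W' (x - y) * u y) \<and>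
      u x = inverse (Xi W f x) * W' (x - d) + (LINT y:{d<..<x}|lborel. inverse (Xi W f x) * f y * W' (x - y) * u y)"
    if "w_solution W W' f d u" "x > d" for f u x
    using that unfolding w_solution_def by (elim conjE allE[of _ x]) (rule mp)
  show "w_solution W W' (\<phi>s (Suc n)) d (ws (Suc n))" for n by (rule assms(2)) simp
qed (fact assms)+

text \<open>Needed because \<open>d\<close> may be negative, so that points \<open>x \<le> 0\<close>
  to the right of \<open>d\<close> occur; there the equation is explicit.\<close>

lemma z_solution_nonpos:
  assumes "z_solution q W W' f z" "x \<le> 0"
  shows "z x = inverse (Xi W f x) * (q * W x)"
proof -
  have "{0<..<x} = {}" using assms(2) by auto
  hence "(LINT y:{0<..<x}|lborel. inverse (Xi W f x) * f y * W' (x - y) * z y) = 0"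
    by (simp add: set_lebesgue_integral_def)
  moreover have "z x = inverse (Xi W f x) * (q * W x) +
      (LINT y:{0<..<x}|lborel. inverse (Xi W f x) * f y * W' (x - y) * z y)"
    using assms(1) unfolding z_solution_def by (elim conjE allE[of _ x])
  ultimately show ?thesis by (simp only: add_0_right)
qed

lemma z_solution_tendsto:
  assumes "z_solution q W W' \<phi> z" and "\<And>n. n \<ge> 1 \<Longrightarrow> z_solution q W W' (\<phi>s n) (zs n)"
  shows "(\<lambda>n. zs n x) \<longlonglongrightarrow> z x"
proof (cases "x > 0")
  case True
  show ?thesis
  proof (rule solution_tendsto[where solves="z_solution q W W'" and d=0 and h="\<lambda>x. q * W x"
        and us=zs and u=z and x=x])
    show "0 \<le> q * W x" for x using q_nonneg W_nonneg by simp
    show "set_borel_measurable lborel {0<..} u" if "z_solution q W W' f u" for f u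
    proof -
      have "u \<in> borel_measurable lborel" using that unfolding z_solution_def by (rule conjunct1)
      thus ?thesis unfolding set_borel_measurable_def by simp
    qed
    show "set_integrable lborel {0<..<x} (\<lambda>y. inverse (Xi W f x) * f y * W' (x - y) * u y) \<and>
        u x = inverse (Xi W f x) * (q * W x) + (LINT y:{0<..<x}|lborel. inverse (Xi W f x) * f y * W' (x - y) * u y)"
      if "z_solution q W W' f u" for f u x
      using that unfolding z_solution_def by (elim conjE allE[of _ x]) (rule conjI)
    show "z_solution q W W' (\<phi>s (Suc n)) (zs (Suc n))" for n by (rule assms(2)) simp
  qed (fact assms True)+
next
  case False
  have "(\<lambda>n. inverse (Xi W (\<phi>s (Suc n)) x) * (q * W x)) \<longlonglongrightarrow> inverse (Xi W \<phi> x) * (q * W x)"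
    by (intro tendsto_mult inverse_Xi_approx_tendsto tendsto_const)
  moreover have "zs (Suc n) x = inverse (Xi W (\<phi>s (Suc n)) x) * (q * W x)" for n
    by (rule z_solution_nonpos[OF assms(2)]) (use False in simp_all)
  moreover have "z x = inverse (Xi W \<phi> x) * (q * W x)"
    by (rule z_solution_nonpos[OF assms(1)]) (use False in simp)
  ultimately have "(\<lambda>n. zs (Suc n) x) \<longlonglongrightarrow> z x" by (simp only:)
  thus ?thesis by (rule LIMSEQ_imp_Suc)
qed

end

theorem theorem27:
  fixes M :: "'a measure" and X :: "real \<Rightarrow> 'a \<Rightarrow> real"
    and \<gamma> \<sigma> q d :: real and \<nu> :: "real measure"
    and W W' \<phi> w z :: "real \<Rightarrow> real"
    and \<phi>s ws zs :: "nat \<Rightarrow> real \<Rightarrow> real"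
  assumes "spectrally_negative_levy M X \<gamma> \<sigma> \<nu>" and "\<not> monotone_paths M X"
    and "q \<ge> 0"
    and "scale_function \<gamma> \<sigma> \<nu> q W" and "right_derivative W W'"
    and "rate_function \<gamma> \<sigma> \<nu> \<phi>" and "approximating_sequence \<phi> \<phi>s"
    and "w_solution W W' \<phi> d w" and "\<And>n. n \<ge> 1 \<Longrightarrow> w_solution W W' (\<phi>s n) d (ws n)"
    and "z_solution q W W' \<phi> z" and "\<And>n. n \<ge> 1 \<Longrightarrow> z_solution q W W' (\<phi>s n) (zs n)"
  shows "\<forall>x>d. (\<lambda>n. ws n x) \<longlonglongrightarrow> w x \<and> (\<lambda>n. zs n x) \<longlonglongrightarrow> z x"
proof -
  \<comment> \<open>The rate is below the drift everywhere and takes the value 0 far to the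
    left.\<close>
  have drift: "0 < levy_drift \<gamma> \<nu>" if "bounded_variation_case \<sigma> \<nu>"
  proof -
    obtain d' where "\<phi> d' = 0" using assms(6) unfolding rate_function_def by blast
    moreover have "\<phi> d' < levy_drift \<gamma> \<nu>" using assms(6) that by (simp add: rate_function_def)
    ultimately show ?thesis by simp
  qed
  interpret levy_volterra \<gamma> \<sigma> q \<nu> W W' \<phi> \<phi>s
  proof unfold_locales
    show "levy_triplet \<sigma> \<nu>" using assms(1) by (simp add: spectrally_negative_levy_def)
  qed (fact assms drift)+
  show ?thesis
    by (intro allI impI conjI w_solution_tendsto[OF assms(8,9)] z_solution_tendsto[OF assms(10,11)])
qed

end
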